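(* Let $\mathcal{H}$ be a Hilbert space, let $Q\in\mathcal{B}(\mathcal{H})$ be a unitary, and let $(T_1,T_2)$ be a pair of $Q$-commuting contractions on $\mathcal{H}$. Then there exist a Hilbert space $\mathcal{K}\supset\mathcal{H}$ and unitaries $U_1,U_2,\widetilde{Q}\in\mathcal{B}(\mathcal{K})$ such that $(U_1,U_2)$ is a pair of $\widetilde{Q}$-commuting unitaries and $$T_1^{k_1}T_2^{k_2}=P_{\mathcal{H}}U_1^{k_1}U_2^{k_2}|_{\mathcal{H}}\qquad\text{for all } k_1,k_2\in\mathbb{Z}_+ .$$ Moreover, $\mathcal{H}$ is a reducing subspace for $\widetilde{Q}$ and $\widetilde{Q}|_{\mathcal{H}}=Q$.
   Context: All Hilbert spaces are complex. $\mathcal{B}(\mathcal{H})$ is the space of bounded linear operators on $\mathcal{H}$; a contraction is an operator of norm at most $1$; $\mathbb{Z}_+$ is the set of non-negative integers. $P_{\mathcal{H}}$ denotes the orthogonal projection in $\mathcal{B}(\mathcal{K})$ with range $\mathcal{H}$. Given $Q\in\mathcal{B}(\mathcal{H})$, a pair of bounded operators $(T_1,T_2)$ on $\mathcal{H}$ is said to be $Q$-commuting if one of the following conditions holds: $T_1T_2=QT_2T_1$, or $T_1T_2=T_2QT_1$, or $T_1T_2=T_2T_1Q$. *)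

theory Defs
  imports "HOL-Analysis.Analysis" "HOL-Library.Function_Algebras"
begin

section \<open>Complex vector spaces and complex Hilbert spaces as type classes\<close>

class complex_vector = ab_group_add +
  fixes scaleC :: "complex \<Rightarrow> 'a \<Rightarrow> 'a"  (infixr "*\<^sub>C" 75)
  assumes scaleC_add_right: "c *\<^sub>C (x + y) = c *\<^sub>C x + c *\<^sub>C y"
    and scaleC_add_left: "(c + d) *\<^sub>C x = c *\<^sub>C x + d *\<^sub>C x"
    and scaleC_scaleC: "c *\<^sub>C (d *\<^sub>C x) = (c * d) *\<^sub>C x"
    and scaleC_one: "1 *\<^sub>C x = x"

text \<open>The inner product \<open>cinner\<close> is linear in its first argument. Norm, metric and topology
  come from the underlying real inner product space, whose inner product is the real part
  of \<open>cinner\<close>.\<close>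

class complex_hilbert_space = complex_vector + real_inner + complete_space +
  fixes cinner :: "'a \<Rightarrow> 'a \<Rightarrow> complex"
  assumes scaleR_scaleC: "r *\<^sub>R x = complex_of_real r *\<^sub>C x"
    and cinner_add_left: "cinner (x + y) z = cinner x z + cinner y z"
    and cinner_scaleC_left: "cinner (c *\<^sub>C x) y = c * cinner x y"
    and cinner_commute: "cinner y x = cnj (cinner x y)"
    and inner_cinner: "inner x y = Re (cinner x y)"

instantiation complex :: complex_hilbert_space
begin

definition scaleC_complex :: "complex \<Rightarrow> complex \<Rightarrow> complex" where
  "scaleC_complex c x = c * x"

definition cinner_complex :: "complex \<Rightarrow> complex \<Rightarrow> complex" where
  "cinner_complex x y = x * cnj y"

instance
  by standard
    (auto simp: scaleC_complex_def cinner_complex_def inner_complex_def algebra_simps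
      scaleR_conv_of_real)

end

instantiation "fun" :: (type, complex_vector) complex_vector
begin

definition scaleC_fun :: "complex \<Rightarrow> ('a \<Rightarrow> 'b) \<Rightarrow> 'a \<Rightarrow> 'b" where
  "scaleC_fun c f = (\<lambda>i. c *\<^sub>C f i)"

instance
  by standard
    (auto simp: scaleC_fun_def fun_eq_iff scaleC_add_right scaleC_add_left scaleC_scaleC
      scaleC_one)

end

section \<open>Hilbert spaces on explicit carriers\<close>

text \<open>HOL cannot quantify existentially over types, so a Hilbert space whose existence is
  asserted is given by a complex linear subspace \<open>S\<close> of some complex vector space, together
  with an inner product \<open>ip\<close> of which only the values on \<open>S\<close> matter. In the same way an
  operator on \<open>S\<close> is a function of which only the values on \<open>S\<close> matter. The case
  \<open>S = UNIV\<close>, \<open>ip = cinner\<close> is that of a type of class \<open>complex_hilbert_space\<close>.\<close>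

definition csubspace :: "'v::complex_vector set \<Rightarrow> bool" where
  "csubspace S \<longleftrightarrow> 0 \<in> S \<and> (\<forall>x\<in>S. \<forall>y\<in>S. x + y \<in> S) \<and> (\<forall>c. \<forall>x\<in>S. c *\<^sub>C x \<in> S)"

definition hnorm :: "('v::complex_vector \<Rightarrow> 'v \<Rightarrow> complex) \<Rightarrow> 'v \<Rightarrow> real" where
  "hnorm ip x = sqrt (Re (ip x x))"

locale hilbert_space_on =
  fixes S :: "'v::complex_vector set" and ip :: "'v \<Rightarrow> 'v \<Rightarrow> complex"
  assumes subspace: "csubspace S"
    and add_left: "\<lbrakk>x \<in> S; y \<in> S; z \<in> S\<rbrakk> \<Longrightarrow> ip (x + y) z = ip x z + ip y z"
    and scale_left: "\<lbrakk>x \<in> S; y \<in> S\<rbrakk> \<Longrightarrow> ip (c *\<^sub>C x) y = c * ip x y"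
    and commute: "\<lbrakk>x \<in> S; y \<in> S\<rbrakk> \<Longrightarrow> ip y x = cnj (ip x y)"
    and positive: "\<lbrakk>x \<in> S; x \<noteq> 0\<rbrakk> \<Longrightarrow> 0 < Re (ip x x)"
    and complete: "\<lbrakk>\<And>n. \<sigma> n \<in> S;
        \<And>e. 0 < e \<Longrightarrow> \<exists>N. \<forall>m\<ge>N. \<forall>n\<ge>N. hnorm ip (\<sigma> m - \<sigma> n) < e\<rbrakk>
      \<Longrightarrow> \<exists>x\<in>S. (\<lambda>n. hnorm ip (\<sigma> n - x)) \<longlonglongrightarrow> 0"

definition closed_csubspace ::
    "'v::complex_vector set \<Rightarrow> ('v \<Rightarrow> 'v \<Rightarrow> complex) \<Rightarrow> 'v set \<Rightarrow> bool" where
  "closed_csubspace S ip M \<longleftrightarrow> csubspace M \<and> M \<subseteq> S \<and>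
     (\<forall>\<sigma>. \<forall>x\<in>S. (\<forall>n. \<sigma> n \<in> M) \<and> (\<lambda>n. hnorm ip (\<sigma> n - x)) \<longlonglongrightarrow> 0 \<longrightarrow> x \<in> M)"

definition clinear_on ::
    "'v::complex_vector set \<Rightarrow> ('v \<Rightarrow> 'w::complex_vector) \<Rightarrow> bool" where
  "clinear_on S T \<longleftrightarrow> (\<forall>x\<in>S. \<forall>y\<in>S. T (x + y) = T x + T y) \<and>
     (\<forall>c. \<forall>x\<in>S. T (c *\<^sub>C x) = c *\<^sub>C T x)"

definition bounded_operator ::
    "'v::complex_vector set \<Rightarrow> ('v \<Rightarrow> 'v \<Rightarrow> complex) \<Rightarrow> ('v \<Rightarrow> 'v) \<Rightarrow> bool" where
  "bounded_operator S ip T \<longleftrightarrow> T ` S \<subseteq> S \<and> clinear_on S T \<and>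
     (\<exists>C. \<forall>x\<in>S. hnorm ip (T x) \<le> C * hnorm ip x)"

definition op_norm ::
    "'v::complex_vector set \<Rightarrow> ('v \<Rightarrow> 'v \<Rightarrow> complex) \<Rightarrow> ('v \<Rightarrow> 'v) \<Rightarrow> real" where
  "op_norm S ip T = (SUP x\<in>{x\<in>S. hnorm ip x \<le> 1}. hnorm ip (T x))"

definition contraction ::
    "'v::complex_vector set \<Rightarrow> ('v \<Rightarrow> 'v \<Rightarrow> complex) \<Rightarrow> ('v \<Rightarrow> 'v) \<Rightarrow> bool" where
  "contraction S ip T \<longleftrightarrow> bounded_operator S ip T \<and> op_norm S ip T \<le> 1"

text \<open>The adjoint is a relation, since operators on \<open>S\<close> are determined only on \<open>S\<close>.\<close>

definition is_adjoint ::
    "'v::complex_vector set \<Rightarrow> ('v \<Rightarrow> 'v \<Rightarrow> complex) \<Rightarrow> ('v \<Rightarrow> 'v) \<Rightarrow> ('v \<Rightarrow> 'v) \<Rightarrow> bool" where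
  "is_adjoint S ip T T' \<longleftrightarrow> bounded_operator S ip T' \<and>
     (\<forall>x\<in>S. \<forall>y\<in>S. ip (T x) y = ip x (T' y))"

definition unitary_operator ::
    "'v::complex_vector set \<Rightarrow> ('v \<Rightarrow> 'v \<Rightarrow> complex) \<Rightarrow> ('v \<Rightarrow> 'v) \<Rightarrow> bool" where
  "unitary_operator S ip U \<longleftrightarrow> bounded_operator S ip U \<and>
     (\<exists>U'. is_adjoint S ip U U' \<and> (\<forall>x\<in>S. U' (U x) = x \<and> U (U' x) = x))"

definition orthogonal_projection_onto ::
    "'v::complex_vector set \<Rightarrow> ('v \<Rightarrow> 'v \<Rightarrow> complex) \<Rightarrow> 'v set \<Rightarrow> ('v \<Rightarrow> 'v) \<Rightarrow> bool" where
  "orthogonal_projection_onto S ip M P \<longleftrightarrow> bounded_operator S ip P \<and>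
     (\<forall>x\<in>S. P (P x) = P x) \<and> is_adjoint S ip P P \<and> P ` S = M"

definition reducing_subspace ::
    "'v::complex_vector set \<Rightarrow> ('v \<Rightarrow> 'v \<Rightarrow> complex) \<Rightarrow> 'v set \<Rightarrow> ('v \<Rightarrow> 'v) \<Rightarrow> bool" where
  "reducing_subspace S ip M T \<longleftrightarrow> closed_csubspace S ip M \<and> T ` M \<subseteq> M \<and>
     (\<exists>T'. is_adjoint S ip T T' \<and> T' ` M \<subseteq> M)"

definition q_commuting ::
    "'v::complex_vector set \<Rightarrow> ('v \<Rightarrow> 'v \<Rightarrow> complex) \<Rightarrow> ('v \<Rightarrow> 'v) \<Rightarrow>
      ('v \<Rightarrow> 'v) \<Rightarrow> ('v \<Rightarrow> 'v) \<Rightarrow> bool" where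
  "q_commuting S ip Q T1 T2 \<longleftrightarrow>
     bounded_operator S ip Q \<and> bounded_operator S ip T1 \<and> bounded_operator S ip T2 \<and>
     ((\<forall>x\<in>S. T1 (T2 x) = Q (T2 (T1 x))) \<or>
      (\<forall>x\<in>S. T1 (T2 x) = T2 (Q (T1 x))) \<or>
      (\<forall>x\<in>S. T1 (T2 x) = T2 (T1 (Q x))))"

text \<open>An inclusion of Hilbert spaces is rendered by a linear isometry \<open>J\<close>, with which the
  smaller space is identified with \<open>range J\<close>.\<close>

definition isometric_embedding ::
    "('a::complex_hilbert_space \<Rightarrow> 'v) \<Rightarrow> 'v::complex_vector set \<Rightarrow>
      ('v \<Rightarrow> 'v \<Rightarrow> complex) \<Rightarrow> bool" where
  "isometric_embedding J S ip \<longleftrightarrow> range J \<subseteq> S \<and> clinear_on UNIV J \<and>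
     (\<forall>x y. ip (J x) (J y) = cinner x y)"

lemma hnorm_cinner: "hnorm cinner x = norm (x :: 'a::complex_hilbert_space)"
  by (simp add: hnorm_def norm_eq_sqrt_inner inner_cinner)

lemma hilbert_space_on_UNIV:
  "hilbert_space_on (UNIV :: 'a::complex_hilbert_space set) cinner"
proof
  show "csubspace (UNIV :: 'a set)"
    by (simp add: csubspace_def)
next
  fix x :: 'a assume "x \<noteq> 0"
  then show "0 < Re (cinner x x)"
    by (simp flip: inner_cinner)
next
  fix \<sigma> :: "nat \<Rightarrow> 'a"
  assume "\<And>e. 0 < e \<Longrightarrow> \<exists>N. \<forall>m\<ge>N. \<forall>n\<ge>N. hnorm cinner (\<sigma> m - \<sigma> n) < e"
  then have "Cauchy \<sigma>"
    by (auto simp: Cauchy_def hnorm_cinner dist_norm)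
  then obtain x where "\<sigma> \<longlonglongrightarrow> x"
    using Cauchy_convergent convergent_def by blast
  then have "(\<lambda>n. hnorm cinner (\<sigma> n - x)) \<longlonglongrightarrow> 0"
    by (simp add: hnorm_cinner LIM_zero tendsto_norm_zero)
  then show "\<exists>x\<in>UNIV. (\<lambda>n. hnorm cinner (\<sigma> n - x)) \<longlonglongrightarrow> 0"
    by blast
qed (auto simp: cinner_add_left cinner_scaleC_left intro: cinner_commute)

end

theory Submission
  imports Defs
begin

text \<open>Each contraction \<open>T\<^sub>i\<close> is the corner of a Julia unitary \<open>J\<^sub>i\<close>; composing it with a bilateral
  shift gives a unitary dilation \<open>V\<^sub>i\<close>. As in Ando's theorem, \<open>V\<^sub>1 V\<^sub>2\<close> and \<open>Q' V\<^sub>2 V\<^sub>1\<close>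
  (or \<open>V\<^sub>2 Q' V\<^sub>1\<close>, \<open>V\<^sub>2 V\<^sub>1 Q'\<close>), with \<open>Q' = Q \<oplus> 1\<close>, are both a shift following a unitary with
  corner \<open>T\<^sub>1 T\<^sub>2\<close>, and they are intertwined by a block diagonal unitary \<open>D\<close> fixing \<open>H\<close>. Then
  \<open>U\<^sub>1 = D V\<^sub>1\<close> and \<open>U\<^sub>2 = V\<^sub>2 D\<^sup>-\<^sup>1\<close> have the required properties.\<close>

section \<open>Complex Hilbert spaces\<close>

text \<open>Two independent unitary dilations satisfy no relation in general; what can be arranged
  is that both orders of multiplication look alike. To this end every coordinate of the sequence
  space has separate slots for the defects of the two contractions, and each of \<open>V1\<close>,
  \<open>V2\<close> shifts only its own slots. The Julia unitary of one factor then commutes with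
  the shift of the other, so both products collapse to the full shift after a single unitary on H
  and coordinate 0. Those two unitaries share only their corner on H. Equal corners give equal Gram
  forms on the defect side, hence an isometry between two subspaces, which may fail to extend to a
  unitary for reasons of dimension. The slots are therefore doubled, and the coordinate space is
  \<open>('a \<times> 'a) \<times> ('a \<times> 'a)\<close>. The correction D cancels in
  \<open>U2 U1\<close> but conjugates \<open>U1 U2\<close>, so it repairs one product without
  disturbing the other. Powers compress correctly because H together with the coordinates of
  positive index is invariant under both unitaries.\<close>

abbreviation clinear :: "('v::complex_vector \<Rightarrow> 'w::complex_vector) \<Rightarrow> bool" where
  "clinear \<equiv> clinear_on UNIV"

lemma clinearI:
  assumes "\<And>x y. T (x + y) = T x + T y" and "\<And>c x. T (c *\<^sub>C x) = c *\<^sub>C T x"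
  shows "clinear T"
  using assms by (simp add: clinear_on_def)

lemma clinear_add: "clinear T \<Longrightarrow> T (x + y) = T x + T y"
  and clinear_scaleC: "clinear T \<Longrightarrow> T (c *\<^sub>C x) = c *\<^sub>C T x"
  by (auto simp: clinear_on_def)

lemma scaleC_zero_right [simp]: "c *\<^sub>C (0::'a::complex_vector) = 0"
  using scaleC_add_right[of c 0 0] by simp

lemma scaleC_zero_left [simp]: "0 *\<^sub>C (x::'a::complex_vector) = 0"
  using scaleC_add_left[of 0 0 x] by simp

lemma scaleC_minus_right: "c *\<^sub>C (- x::'a::complex_vector) = - (c *\<^sub>C x)"
  using scaleC_add_right[of c "- x" x] by (simp add: eq_neg_iff_add_eq_0)

lemma scaleC_diff_right: "c *\<^sub>C (x - y::'a::complex_vector) = c *\<^sub>C x - c *\<^sub>C y"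
  using scaleC_add_right[of c x "- y"] by (simp add: scaleC_minus_right)

lemma clinear_zero: "clinear T \<Longrightarrow> T 0 = 0"
  using clinear_add[of T 0 0] by simp

lemma clinear_minus: "clinear T \<Longrightarrow> T (- x) = - T x"
  using clinear_add[of T "- x" x] by (simp add: clinear_zero eq_neg_iff_add_eq_0)

lemma clinear_diff: "clinear T \<Longrightarrow> T (x - y) = T x - T y"
  using clinear_add[of T x "- y"] by (simp add: clinear_minus)

lemma clinear_compose: "clinear S \<Longrightarrow> clinear T \<Longrightarrow> clinear (S \<circ> T)"
  by (simp add: clinear_on_def)

lemma clinear_scaleR:
  fixes T :: "'a::complex_hilbert_space \<Rightarrow> 'b::complex_hilbert_space"
  shows "clinear T \<Longrightarrow> T (r *\<^sub>R x) = r *\<^sub>R T x"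
  by (simp add: scaleR_scaleC clinear_scaleC)

lemma clinear_bounded_linear:
  fixes T :: "'a::complex_hilbert_space \<Rightarrow> 'b::complex_hilbert_space"
  assumes "clinear T" and "\<And>x. norm (T x) \<le> C * norm x"
  shows "bounded_linear T"
  using assms by (intro bounded_linear_intro[where K = C])
    (auto simp: clinear_add clinear_scaleR mult.commute)

lemma cinner_zero_left [simp]: "cinner 0 (x::'a::complex_hilbert_space) = 0"
  using cinner_add_left[of 0 0 x] by simp

lemma cinner_zero_right [simp]: "cinner (x::'a::complex_hilbert_space) 0 = 0"
  using cinner_commute[of x 0] by simp

lemma cinner_add_right: "cinner (x::'a::complex_hilbert_space) (y + z) = cinner x y + cinner x z"
  by (metis cinner_add_left cinner_commute complex_cnj_add)

lemma cinner_scaleC_right: "cinner (x::'a::complex_hilbert_space) (c *\<^sub>C y) = cnj c * cinner x y"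
  by (metis cinner_scaleC_left cinner_commute complex_cnj_mult)

lemma cinner_minus_left: "cinner (- x) (y::'a::complex_hilbert_space) = - cinner x y"
  using cinner_add_left[of "- x" x y] by (simp add: eq_neg_iff_add_eq_0)

lemma cinner_minus_right: "cinner x (- y::'a::complex_hilbert_space) = - cinner x y"
  using cinner_add_right[of x "- y" y] by (simp add: eq_neg_iff_add_eq_0)

lemma cinner_diff_left: "cinner (x - y) (z::'a::complex_hilbert_space) = cinner x z - cinner y z"
  using cinner_add_left[of x "- y" z] by (simp add: cinner_minus_left)

lemma cinner_diff_right: "cinner x (y - z::'a::complex_hilbert_space) = cinner x y - cinner x z"
  using cinner_add_right[of x y "- z"] by (simp add: cinner_minus_right)

lemmas cinner_simps = cinner_add_left cinner_add_right cinner_diff_left cinner_diff_right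
  cinner_minus_left cinner_minus_right cinner_scaleC_left cinner_scaleC_right

text \<open>The imaginary part is the real inner product with \<open>\<i> *\<^sub>C y\<close>. Hence
  an identity for \<open>inner\<close> that holds for all vectors of a complex subspace passes to
  \<open>cinner\<close>.\<close>

lemma cinner_conv_inner:
  "cinner (x::'a::complex_hilbert_space) y = Complex (inner x y) (inner x (\<i> *\<^sub>C y))"
  by (simp add: complex_eq_iff inner_cinner cinner_scaleC_right)

lemma cinner_self: "cinner x x = complex_of_real ((norm (x::'a::complex_hilbert_space))\<^sup>2)"
  using cinner_commute[of x x]
  by (simp add: complex_eq_iff power2_norm_eq_inner inner_cinner)

lemma cinner_eqI:
  assumes "\<And>z. cinner x z = cinner y (z::'a::complex_hilbert_space)"
  shows "x = y"
proof -
  have "inner (x - y) (x - y) = 0"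
    by (simp add: inner_cinner cinner_diff_left assms)
  then show ?thesis by simp
qed

lemma norm_scaleC: "norm (c *\<^sub>C (x::'a::complex_hilbert_space)) = cmod c * norm x"
proof -
  have "complex_of_real ((norm (c *\<^sub>C x))\<^sup>2) = c * cnj c * cinner x x"
    by (subst cinner_self[symmetric]) (simp add: cinner_scaleC_left cinner_scaleC_right)
  also have "\<dots> = complex_of_real ((cmod c * norm x)\<^sup>2)"
    by (simp only: cinner_self complex_norm_square[symmetric] power_mult_distrib of_real_mult)
  finally show ?thesis
    by (simp only: of_real_eq_iff power2_eq_iff_nonneg norm_ge_zero mult_nonneg_nonneg)
qed

lemma cinner_cauchy_schwarz: "cmod (cinner x (y::'a::complex_hilbert_space)) \<le> norm x * norm y"
proof -
  \<comment> \<open>The phase of the inner product, 0 if that vanishes. Replacing y by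
    \<open>s *\<^sub>C y\<close> makes the inner product real and non-negative, which leaves the
    real inequality.\<close>
  define s where "s = sgn (cinner x y)"
  have "cmod s \<le> 1" by (simp add: s_def norm_sgn)
  have "cmod (cinner x y) = Re (cnj s * cinner x y)"
    by (simp add: s_def sgn_div_norm scaleR_conv_of_real complex_mult_cnj cmod_def
        power2_eq_square[symmetric] real_div_sqrt field_simps)
  also have "\<dots> = inner x (s *\<^sub>C y)"
    by (simp add: inner_cinner cinner_scaleC_right)
  also have "\<dots> \<le> norm x * norm (s *\<^sub>C y)" by (rule norm_cauchy_schwarz)
  also have "\<dots> \<le> norm x * norm y"
    using \<open>cmod s \<le> 1\<close> by (intro mult_left_mono) (auto simp: norm_scaleC intro: mult_left_le_one_le)
  finally show ?thesis .
qed

section \<open>Orthogonal sums of two Hilbert spaces\<close>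

instantiation prod :: (complex_vector, complex_vector) complex_vector
begin

definition scaleC_prod :: "complex \<Rightarrow> 'a \<times> 'b \<Rightarrow> 'a \<times> 'b" where
  "scaleC_prod c x = (c *\<^sub>C fst x, c *\<^sub>C snd x)"

instance
  by standard
    (auto simp: scaleC_prod_def scaleC_add_right scaleC_add_left scaleC_scaleC scaleC_one)

end

lemma fst_scaleC [simp]: "fst (c *\<^sub>C x) = c *\<^sub>C fst x"
  and snd_scaleC [simp]: "snd (c *\<^sub>C x) = c *\<^sub>C snd x"
  and scaleC_Pair [simp]: "c *\<^sub>C (a, b) = (c *\<^sub>C a, c *\<^sub>C b)"
  by (auto simp: scaleC_prod_def)

instantiation prod :: (complex_hilbert_space, complex_hilbert_space) complex_hilbert_space
begin

definition cinner_prod :: "'a \<times> 'b \<Rightarrow> 'a \<times> 'b \<Rightarrow> complex" where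
  "cinner_prod x y = cinner (fst x) (fst y) + cinner (snd x) (snd y)"

instance
proof
  fix x y z :: "'a \<times> 'b" and r :: real and c :: complex
  show "r *\<^sub>R x = complex_of_real r *\<^sub>C x"
    by (simp add: prod_eq_iff scaleR_scaleC)
  show "cinner y x = cnj (cinner x y)"
    by (simp add: cinner_prod_def flip: cinner_commute)
qed (auto simp: cinner_prod_def cinner_simps inner_prod_def inner_cinner algebra_simps)

end

section \<open>Square-summable families\<close>

typedef (overloaded) ('i, 'a::complex_hilbert_space) l2 =
  "{x :: 'i \<Rightarrow> 'a. (\<lambda>n. (norm (x n))\<^sup>2) summable_on UNIV}"
  morphisms coord Abs_l2
  by (intro exI[of _ "\<lambda>_. 0"]) simp

setup_lifting type_definition_l2

lemma summable_norm_sq: "(\<lambda>n. (norm (coord x n))\<^sup>2) summable_on UNIV"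
  using coord by blast

lemma l2_eqI: "(\<And>n. coord x n = coord y n) \<Longrightarrow> x = y"
  by (metis coord_inject ext)

text \<open>The parallelogram law with the square of the difference dropped.\<close>

lemma square_summable_add:
  fixes f g :: "'i \<Rightarrow> 'a::real_inner"
  assumes "(\<lambda>n. (norm (f n))\<^sup>2) summable_on A" and "(\<lambda>n. (norm (g n))\<^sup>2) summable_on A"
  shows "(\<lambda>n. (norm (f n + g n))\<^sup>2) summable_on A"
proof (rule summable_on_comparison_test)
  show "(\<lambda>n. 2 * (norm (f n))\<^sup>2 + 2 * (norm (g n))\<^sup>2) summable_on A"
    by (intro summable_on_add summable_on_cmult_right assms)
  show "(norm (f n + g n))\<^sup>2 \<le> 2 * (norm (f n))\<^sup>2 + 2 * (norm (g n))\<^sup>2" for n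
  proof -
    have "(norm (f n + g n))\<^sup>2 + (norm (f n - g n))\<^sup>2 = 2 * (norm (f n))\<^sup>2 + 2 * (norm (g n))\<^sup>2"
      by (simp add: power2_norm_eq_inner inner_simps inner_commute)
    then show ?thesis by (smt (verit) zero_le_power2)
  qed
qed auto

instantiation l2 :: (type, complex_hilbert_space) complex_vector
begin

lift_definition zero_l2 :: "('a, 'b) l2" is "\<lambda>_. 0" by simp

lift_definition plus_l2 :: "('a, 'b) l2 \<Rightarrow> ('a, 'b) l2 \<Rightarrow> ('a, 'b) l2"
  is "\<lambda>x y n. x n + y n" by (rule square_summable_add)

lift_definition uminus_l2 :: "('a, 'b) l2 \<Rightarrow> ('a, 'b) l2" is "\<lambda>x n. - x n" by simp

lift_definition minus_l2 :: "('a, 'b) l2 \<Rightarrow> ('a, 'b) l2 \<Rightarrow> ('a, 'b) l2"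
  is "\<lambda>x y n. x n - y n"
  using square_summable_add[of _ UNIV "\<lambda>n. - _ n"] by simp

lift_definition scaleC_l2 :: "complex \<Rightarrow> ('a, 'b) l2 \<Rightarrow> ('a, 'b) l2"
  is "\<lambda>c x n. c *\<^sub>C x n"
  by (simp add: norm_scaleC power_mult_distrib summable_on_cmult_right)

instance
  by standard
    (transfer; auto simp: scaleC_add_right scaleC_add_left scaleC_scaleC scaleC_one)+

end

lemma coord_zero [simp]: "coord 0 n = 0"
  and coord_add [simp]: "coord (x + y) n = coord x n + coord y n"
  and coord_minus [simp]: "coord (x - y) n = coord x n - coord y n"
  and coord_scaleC [simp]: "coord (c *\<^sub>C x) n = c *\<^sub>C coord x n"
  by (transfer; simp)+

lemma cinner_abs_summable:
  "(\<lambda>n. norm (cinner (coord x n) (coord y n))) summable_on UNIV"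
proof (rule summable_on_comparison_test)
  show "(\<lambda>n. (norm (coord x n))\<^sup>2 + (norm (coord y n))\<^sup>2) summable_on UNIV"
    by (intro summable_on_add summable_norm_sq)
  show "cmod (cinner (coord x n) (coord y n)) \<le> (norm (coord x n))\<^sup>2 + (norm (coord y n))\<^sup>2" for n
    using cinner_cauchy_schwarz[of "coord x n" "coord y n"]
      sum_squares_bound[of "norm (coord x n)" "norm (coord y n)"]
      mult_nonneg_nonneg[OF norm_ge_zero[of "coord x n"] norm_ge_zero[of "coord y n"]]
    by linarith
qed auto

lemma cinner_summable: "(\<lambda>n. cinner (coord x n) (coord y n)) summable_on UNIV"
  by (rule abs_summable_summable[OF cinner_abs_summable])

text \<open>This and the next identities concern the bare sum, because the real inner product is
  defined as its real part and has to be in place before \<open>cinner\<close> can be introduced on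
  the type.\<close>

lemma cinner_sum_add:
  "(\<Sum>\<^sub>\<infinity>n. cinner (coord (x + y) n) (coord z n)) =
    (\<Sum>\<^sub>\<infinity>n. cinner (coord x n) (coord z n)) + (\<Sum>\<^sub>\<infinity>n. cinner (coord y n) (coord z n))"
  by (simp add: cinner_add_left infsum_add cinner_summable)

lemma cinner_sum_scaleC:
  "(\<Sum>\<^sub>\<infinity>n. cinner (coord (c *\<^sub>C x) n) (coord z n)) =
    c * (\<Sum>\<^sub>\<infinity>n. cinner (coord x n) (coord z n))"
  by (simp add: cinner_scaleC_left infsum_cmult_right cinner_summable)

lemma cinner_sum_commute:
  "(\<Sum>\<^sub>\<infinity>n. cinner (coord y n) (coord x n)) = cnj (\<Sum>\<^sub>\<infinity>n. cinner (coord x n) (coord y n))"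
  by (simp flip: infsum_cnj cinner_commute)

lemma cinner_sum_self:
  "Re (\<Sum>\<^sub>\<infinity>n. cinner (coord x n) (coord x n)) = (\<Sum>\<^sub>\<infinity>n. (norm (coord x n))\<^sup>2)"
  by (subst infsum_Re[OF cinner_summable, symmetric]) (simp add: cinner_self)

instantiation l2 :: (type, complex_hilbert_space) real_inner
begin

definition inner_l2 :: "('a, 'b) l2 \<Rightarrow> ('a, 'b) l2 \<Rightarrow> real" where
  "inner_l2 x y = Re (\<Sum>\<^sub>\<infinity>n. cinner (coord x n) (coord y n))"

definition scaleR_l2 :: "real \<Rightarrow> ('a, 'b) l2 \<Rightarrow> ('a, 'b) l2" where
  "scaleR_l2 r x = complex_of_real r *\<^sub>C x"

definition norm_l2 :: "('a, 'b) l2 \<Rightarrow> real" where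
  "norm_l2 x = sqrt (inner x x)"

definition dist_l2 :: "('a, 'b) l2 \<Rightarrow> ('a, 'b) l2 \<Rightarrow> real" where
  "dist_l2 x y = norm (x - y)"

definition sgn_l2 :: "('a, 'b) l2 \<Rightarrow> ('a, 'b) l2" where
  "sgn_l2 x = inverse (norm x) *\<^sub>R x"

definition uniformity_l2 :: "(('a, 'b) l2 \<times> ('a, 'b) l2) filter" where
  "uniformity_l2 = (INF e\<in>{0<..}. principal {(x, y). dist x y < e})"

definition open_l2 :: "('a, 'b) l2 set \<Rightarrow> bool" where
  "open_l2 U \<longleftrightarrow> (\<forall>x\<in>U. eventually (\<lambda>(x', y). x' = x \<longrightarrow> y \<in> U) uniformity)"

instance
proof
  fix x y z :: "('a, 'b) l2" and r s :: real
  show "r *\<^sub>R (x + y) = r *\<^sub>R x + r *\<^sub>R y" "(r + s) *\<^sub>R x = r *\<^sub>R x + s *\<^sub>R x"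
    "r *\<^sub>R s *\<^sub>R x = (r * s) *\<^sub>R x" "1 *\<^sub>R x = x"
    by (simp_all add: scaleR_l2_def scaleC_add_right scaleC_add_left scaleC_scaleC scaleC_one)
  show "inner x y = inner y x"
    unfolding inner_l2_def by (subst cinner_sum_commute) simp
  show "inner (x + y) z = inner x z + inner y z"
    unfolding inner_l2_def cinner_sum_add by simp
  show "inner (r *\<^sub>R x) y = r * inner x y"
    unfolding inner_l2_def scaleR_l2_def cinner_sum_scaleC by simp
  show "0 \<le> inner x x"
    unfolding inner_l2_def cinner_sum_self by (rule infsum_nonneg) simp
  show "inner x x = 0 \<longleftrightarrow> x = 0"
  proof
    assume "inner x x = 0"
    then have *: "(\<Sum>\<^sub>\<infinity>n. (norm (coord x n))\<^sup>2) = 0"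
      by (simp add: inner_l2_def cinner_sum_self)
    have "(norm (coord x n))\<^sup>2 = 0" for n
      by (rule nonneg_infsum_le_0D[where A = UNIV and f = "\<lambda>n. (norm (coord x n))\<^sup>2"])
        (auto simp: * summable_norm_sq)
    then show "x = 0" by (intro l2_eqI) simp
  qed (simp add: inner_l2_def)
qed (simp_all only: sgn_l2_def uniformity_l2_def open_l2_def dist_l2_def norm_l2_def)

end

section \<open>Norm and completeness of the sequence space\<close>

lemma norm_l2_sq: "(norm x)\<^sup>2 = (\<Sum>\<^sub>\<infinity>n. (norm (coord x n))\<^sup>2)"
  by (simp add: power2_norm_eq_inner inner_l2_def cinner_sum_self)

lemma norm_coord_le: "norm (coord x n) \<le> norm x"
proof -
  have "sum (\<lambda>n. (norm (coord x n))\<^sup>2) {n} \<le> (\<Sum>\<^sub>\<infinity>n. (norm (coord x n))\<^sup>2)"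
    by (intro finite_sum_le_infsum summable_norm_sq) auto
  then show ?thesis
    by (simp flip: norm_l2_sq)
qed

text \<open>The coordinates converge separately. Over a finite index set the Cauchy bound survives
  the limit in the second index, with a constant independent of the set; letting the set grow then
  gives both summability and convergence in norm.\<close>

lemma l2_complete:
  fixes \<sigma> :: "nat \<Rightarrow> ('i, 'a::complex_hilbert_space) l2"
  assumes "Cauchy \<sigma>"
  shows "convergent \<sigma>"
proof -
  have "Cauchy (\<lambda>k. coord (\<sigma> k) n)" for n
    unfolding Cauchy_def dist_norm
  proof (intro allI impI)
    fix e :: real assume "0 < e"
    then obtain N where "\<forall>k\<ge>N. \<forall>l\<ge>N. norm (\<sigma> k - \<sigma> l) < e"
      using assms unfolding Cauchy_def dist_norm by blast
    then show "\<exists>N. \<forall>k\<ge>N. \<forall>l\<ge>N. norm (coord (\<sigma> k) n - coord (\<sigma> l) n) < e"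
      by (metis norm_coord_le coord_minus le_less_trans)
  qed
  then have "\<forall>n. \<exists>f. (\<lambda>k. coord (\<sigma> k) n) \<longlonglongrightarrow> f"
    using Cauchy_convergent convergent_def by blast
  then obtain f where f: "\<And>n. (\<lambda>k. coord (\<sigma> k) n) \<longlonglongrightarrow> f n"
    by metis
  have tail: "\<exists>N. \<forall>k\<ge>N. (\<lambda>n. (norm (coord (\<sigma> k) n - f n))\<^sup>2) summable_on UNIV \<and>
      (\<Sum>\<^sub>\<infinity>n. (norm (coord (\<sigma> k) n - f n))\<^sup>2) \<le> e\<^sup>2" if "0 < e" for e
  proof -
    obtain N where N: "\<And>k l. k \<ge> N \<Longrightarrow> l \<ge> N \<Longrightarrow> norm (\<sigma> k - \<sigma> l) < e"
      using assms \<open>0 < e\<close> unfolding Cauchy_def dist_norm by blast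
    have fin: "(\<Sum>n\<in>F. (norm (coord (\<sigma> k) n - f n))\<^sup>2) \<le> e\<^sup>2" if "k \<ge> N" "finite F" for k F
    proof (rule LIMSEQ_le_const2)
      show "(\<lambda>l. \<Sum>n\<in>F. (norm (coord (\<sigma> k) n - coord (\<sigma> l) n))\<^sup>2)
          \<longlonglongrightarrow> (\<Sum>n\<in>F. (norm (coord (\<sigma> k) n - f n))\<^sup>2)"
        by (intro tendsto_intros f)
      have "(\<Sum>n\<in>F. (norm (coord (\<sigma> k) n - coord (\<sigma> l) n))\<^sup>2) \<le> e\<^sup>2" if "l \<ge> N" for l
      proof -
        have "(\<Sum>n\<in>F. (norm (coord (\<sigma> k) n - coord (\<sigma> l) n))\<^sup>2) \<le> (norm (\<sigma> k - \<sigma> l))\<^sup>2"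
          unfolding norm_l2_sq coord_minus[symmetric]
          by (intro finite_sum_le_infsum summable_norm_sq \<open>finite F\<close>) auto
        also have "\<dots> \<le> e\<^sup>2"
          using N[OF \<open>k \<ge> N\<close> \<open>l \<ge> N\<close>] by (intro power_mono) auto
        finally show ?thesis .
      qed
      then show "\<exists>M. \<forall>l\<ge>M. (\<Sum>n\<in>F. (norm (coord (\<sigma> k) n - coord (\<sigma> l) n))\<^sup>2) \<le> e\<^sup>2"
        by blast
    qed
    have "(\<lambda>n. (norm (coord (\<sigma> k) n - f n))\<^sup>2) summable_on UNIV \<and>
      (\<Sum>\<^sub>\<infinity>n. (norm (coord (\<sigma> k) n - f n))\<^sup>2) \<le> e\<^sup>2" if "k \<ge> N" for k
    proof
      show *: "(\<lambda>n. (norm (coord (\<sigma> k) n - f n))\<^sup>2) summable_on UNIV"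
        by (rule nonneg_bounded_partial_sums_imp_summable_on[where C = "e\<^sup>2"])
          (auto simp: fin[OF \<open>k \<ge> N\<close>] intro!: eventually_finite_subsets_at_top_weakI)
      show "(\<Sum>\<^sub>\<infinity>n. (norm (coord (\<sigma> k) n - f n))\<^sup>2) \<le> e\<^sup>2"
        by (rule infsum_le_finite_sums[OF *]) (rule fin[OF \<open>k \<ge> N\<close>])
    qed
    then show ?thesis by blast
  qed
  \<comment> \<open>The limit is itself square-summable, being the sum of one member of the sequence
    and a square-summable difference.\<close>
  obtain k where k: "(\<lambda>n. (norm (coord (\<sigma> k) n - f n))\<^sup>2) summable_on UNIV"
    using tail[of 1] by auto
  have "(\<lambda>n. (norm (coord (\<sigma> k) n + (f n - coord (\<sigma> k) n)))\<^sup>2) summable_on UNIV"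
    using k by (intro square_summable_add summable_norm_sq) (simp add: norm_minus_commute)
  then have "coord (Abs_l2 f) = f"
    by (simp add: Abs_l2_inverse)
  have "\<sigma> \<longlonglongrightarrow> Abs_l2 f"
    unfolding LIMSEQ_iff
  proof (intro allI impI)
    fix e :: real assume "0 < e"
    obtain N where N: "\<And>k. k \<ge> N \<Longrightarrow> (\<Sum>\<^sub>\<infinity>n. (norm (coord (\<sigma> k) n - f n))\<^sup>2) \<le> (e / 2)\<^sup>2"
      using tail[of "e / 2"] \<open>0 < e\<close> by auto
    have "norm (\<sigma> k - Abs_l2 f) < e" if "k \<ge> N" for k
    proof -
      have "(norm (\<sigma> k - Abs_l2 f))\<^sup>2 \<le> (e / 2)\<^sup>2"
        using N[OF that] by (simp add: norm_l2_sq \<open>coord (Abs_l2 f) = f\<close>)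
      then have "norm (\<sigma> k - Abs_l2 f) \<le> e / 2"
        by (rule power2_le_imp_le) (use \<open>0 < e\<close> in simp)
      then show ?thesis using \<open>0 < e\<close> by simp
    qed
    then show "\<exists>N. \<forall>k\<ge>N. norm (\<sigma> k - Abs_l2 f) < e" by blast
  qed
  then show ?thesis by (auto simp: convergent_def)
qed

instantiation l2 :: (type, complex_hilbert_space) complex_hilbert_space
begin

definition cinner_l2 :: "('a, 'b) l2 \<Rightarrow> ('a, 'b) l2 \<Rightarrow> complex" where
  "cinner_l2 x y = (\<Sum>\<^sub>\<infinity>n. cinner (coord x n) (coord y n))"

instance
proof
  fix x y z :: "('a, 'b) l2" and r :: real and c :: complex
  show "r *\<^sub>R x = complex_of_real r *\<^sub>C x" by (fact scaleR_l2_def)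
  show "cinner (x + y) z = cinner x z + cinner y z"
    unfolding cinner_l2_def by (fact cinner_sum_add)
  show "cinner (c *\<^sub>C x) y = c * cinner x y"
    unfolding cinner_l2_def by (fact cinner_sum_scaleC)
  show "cinner y x = cnj (cinner x y)"
    unfolding cinner_l2_def by (fact cinner_sum_commute)
  show "inner x y = Re (cinner x y)"
    unfolding cinner_l2_def by (fact inner_l2_def)
qed (fact l2_complete)

end

text \<open>Makes the bounded operators on such a space complete, which the iteration for the square
  root relies on.\<close>

instance complex_hilbert_space \<subseteq> banach ..

section \<open>Unitary maps\<close>

text \<open>Phrased without an adjoint; \<open>unitary_adjoint\<close> shows that the inverse takes
  that role.\<close>

definition unitary :: "('a::complex_hilbert_space \<Rightarrow> 'b::complex_hilbert_space) \<Rightarrow> bool" where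
  "unitary U \<longleftrightarrow> clinear U \<and> surj U \<and> (\<forall>x y. cinner (U x) (U y) = cinner x y)"

lemma unitaryI:
  assumes "clinear U" and "\<And>x. U (V x) = x" and "\<And>x y. cinner (U x) (U y) = cinner x y"
  shows "unitary U"
  using assms unfolding unitary_def by (metis surjI)

lemma unitary_clinear: "unitary U \<Longrightarrow> clinear U"
  and unitary_cinner: "unitary U \<Longrightarrow> cinner (U x) (U y) = cinner x y"
  by (auto simp: unitary_def)

lemma unitary_norm: "unitary U \<Longrightarrow> norm (U x) = norm x"
  by (simp add: norm_eq_sqrt_inner inner_cinner unitary_cinner)

lemma unitary_bij:
  assumes "unitary U"
  shows "bij U"
proof -
  have "inj U"
  proof (rule injI)
    fix x y assume "U x = U y"
    then have "norm (x - y) = 0"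
      using unitary_norm[OF assms, of "x - y"] clinear_diff[OF unitary_clinear[OF assms]] by simp
    then show "x = y" by simp
  qed
  then show ?thesis using assms by (simp add: bij_def unitary_def)
qed

lemma unitary_inv_left [simp]: "unitary U \<Longrightarrow> inv U (U x) = x"
  by (simp add: unitary_bij bij_is_inj)

lemma unitary_inv_right [simp]: "unitary U \<Longrightarrow> U (inv U x) = x"
  by (simp add: unitary_bij bij_is_surj surj_f_inv_f)

lemma unitary_inv:
  assumes "unitary U"
  shows "unitary (inv U)"
proof (rule unitaryI[where V = U])
  have *: "inv U x = y" if "U y = x" for x y
    using assms that by auto
  note lin = unitary_clinear[OF assms]
  show "clinear (inv U)"
    by (rule clinearI; rule *) (simp_all add: clinear_add[OF lin] clinear_scaleC[OF lin] assms)
  show "cinner (inv U x) (inv U y) = cinner x y" for x y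
    using unitary_cinner[OF assms, of "inv U x" "inv U y"] assms by simp
qed (simp add: assms)

lemma unitary_compose: "unitary U \<Longrightarrow> unitary V \<Longrightarrow> unitary (U \<circ> V)"
  by (intro unitaryI[where V = "inv V \<circ> inv U"])
    (auto simp: unitary_cinner clinear_compose unitary_clinear)

lemma unitary_adjoint: "unitary U \<Longrightarrow> cinner (U x) y = cinner x (inv U y)"
  by (metis unitary_cinner unitary_inv_right)

lemma unitary_swap: "unitary prod.swap"
  by (rule unitaryI[where V = prod.swap]) (auto intro: clinearI simp: cinner_prod_def)

section \<open>Orthogonal projections and adjoints\<close>

text \<open>The minimiser over \<open>M\<close> of the squared norm of \<open>y\<close> minus \<open>2 f y\<close> represents \<open>f\<close>. This
  yields the Riesz theorem for \<open>M = UNIV\<close> and orthogonal projections for \<open>f\<close> an inner product.\<close>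

lemma representer_on_closed_subspace:
  fixes M :: "'a::complex_hilbert_space set" and f :: "'a \<Rightarrow> real"
  assumes "closed M" and "subspace M" and "bounded_linear f"
  obtains y where "y \<in> M" and "\<And>z. z \<in> M \<Longrightarrow> inner y z = f z"
proof -
  interpret f: bounded_linear f by fact
  obtain B where B: "\<And>x. norm (f x) \<le> norm x * B"
    using f.bounded by blast
  define \<phi> where "\<phi> y = (norm y)\<^sup>2 - 2 * f y" for y
  define m where "m = Inf (\<phi> ` M)"
  have "- (B\<^sup>2) \<le> \<phi> y" for y
  proof -
    have "f y \<le> norm y * B" using B[of y] by simp
    moreover have "0 \<le> (norm y - B)\<^sup>2" by simp
    ultimately show ?thesis by (simp add: \<phi>_def power2_diff algebra_simps)
  qed
  then have bdd: "bdd_below (\<phi> ` M)" by (rule bdd_belowI2)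
  have "0 \<in> M" using \<open>subspace M\<close> by (rule subspace_0)
  have m_le: "m \<le> \<phi> y" if "y \<in> M" for y
    unfolding m_def using bdd that by (simp add: cINF_lower)
  have "\<exists>y\<in>M. \<phi> y < m + 1 / real (Suc n)" for n
  proof -
    have "Inf (\<phi> ` M) < m + 1 / real (Suc n)" by (simp add: m_def)
    then show ?thesis using cINF_less_iff[OF _ bdd] \<open>0 \<in> M\<close> by blast
  qed
  then obtain Y where Y: "\<And>n. Y n \<in> M" "\<And>n. \<phi> (Y n) < m + 1 / real (Suc n)" by metis
  \<comment> \<open>The parallelogram law, applied with the midpoint as competitor: near-minimisers
    are close to one another, so a minimising sequence is Cauchy.\<close>
  have close: "(norm (x - y))\<^sup>2 \<le> 2 * (\<phi> x - m) + 2 * (\<phi> y - m)" if "x \<in> M" "y \<in> M" for x y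
  proof -
    have "(1/2) *\<^sub>R (x + y) \<in> M"
      using that \<open>subspace M\<close> by (intro subspace_scale subspace_add)
    then have "m \<le> \<phi> ((1/2) *\<^sub>R (x + y))" by (rule m_le)
    moreover have "\<phi> x + \<phi> y = 2 * \<phi> ((1/2) *\<^sub>R (x + y)) + (norm (x - y))\<^sup>2 / 2"
      by (simp add: \<phi>_def power2_norm_eq_inner f.add f.scaleR inner_simps inner_commute
          field_simps)
    ultimately show ?thesis by simp
  qed
  have "Cauchy Y"
    unfolding Cauchy_def dist_norm
  proof (intro allI impI)
    fix e :: real assume "0 < e"
    then obtain N where N: "4 / e\<^sup>2 < real N" using reals_Archimedean2 by blast
    have "norm (Y k - Y l) < e" if "k \<ge> N" "l \<ge> N" for k l
    proof -
      have *: "\<phi> (Y k) - m < e\<^sup>2 / 4" if "k \<ge> N" for k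
      proof -
        have "4 / e\<^sup>2 < real (Suc k)" using N that by simp
        then have "1 / real (Suc k) < e\<^sup>2 / 4"
          using \<open>0 < e\<close> by (simp add: field_simps)
        then show ?thesis using Y(2)[of k] by simp
      qed
      have "(norm (Y k - Y l))\<^sup>2 < e\<^sup>2"
        using close[OF Y(1) Y(1), of k l] *[OF that(1)] *[OF that(2)] by simp
      then show ?thesis using \<open>0 < e\<close> by (simp add: power_less_imp_less_base)
    qed
    then show "\<exists>N. \<forall>k\<ge>N. \<forall>l\<ge>N. norm (Y k - Y l) < e" by blast
  qed
  then obtain y where y: "Y \<longlonglongrightarrow> y"
    using Cauchy_convergent convergent_def by blast
  have "y \<in> M"
    using \<open>closed M\<close> Y(1) y closed_sequentially by blast
  have "\<phi> y \<le> m"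
  proof (rule LIMSEQ_le)
    show "(\<lambda>n. \<phi> (Y n)) \<longlonglongrightarrow> \<phi> y"
      unfolding \<phi>_def by (intro tendsto_intros y f.tendsto)
    show "(\<lambda>n. m + 1 / real (Suc n)) \<longlonglongrightarrow> m"
      using LIMSEQ_inverse_real_of_nat_add[of m] by (simp add: inverse_eq_divide)
    show "\<exists>N. \<forall>n\<ge>N. \<phi> (Y n) \<le> m + 1 / real (Suc n)"
      using Y(2) less_imp_le by blast
  qed
  have "inner y z = f z" if "z \<in> M" for z
  proof (rule ccontr)
    define d where "d = inner y z - f z"
    assume "inner y z \<noteq> f z"
    then have "d \<noteq> 0" by (simp add: d_def)
    \<comment> \<open>The exact minimiser of
      \<open>2 * t * d + t * t * ((norm z)\<^sup>2 + 1)\<close>. The added 1 keeps the denominator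
      positive, also for z = 0, and makes the decrease strict.\<close>
    define t where "t = - d / ((norm z)\<^sup>2 + 1)"
    have pos: "0 < (norm z)\<^sup>2 + 1" by (smt (verit) zero_le_power2)
    have "y + t *\<^sub>R z \<in> M"
      using \<open>y \<in> M\<close> that \<open>subspace M\<close> by (intro subspace_add subspace_scale)
    then have "\<phi> y \<le> \<phi> (y + t *\<^sub>R z)" using m_le \<open>\<phi> y \<le> m\<close> by fastforce
    also have "\<phi> (y + t *\<^sub>R z) = \<phi> y + 2 * t * d + t * t * (norm z)\<^sup>2"
      by (simp add: \<phi>_def power2_norm_eq_inner f.add f.scaleR inner_simps inner_commute d_def
          algebra_simps)
    finally have "0 \<le> 2 * t * d + t * t * (norm z)\<^sup>2" by simp
    moreover have "t * t * (norm z)\<^sup>2 \<le> - t * d"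
    proof -
      have "t * ((norm z)\<^sup>2 + 1) = - d" using pos by (simp add: t_def)
      then have "t * (t * ((norm z)\<^sup>2 + 1)) = - t * d" by simp
      then have "t * t * (norm z)\<^sup>2 = - t * d - t * t" by (simp add: algebra_simps)
      then show ?thesis using zero_le_square[of t] by linarith
    qed
    ultimately have "0 \<le> t * d" by simp
    moreover have "t * d < 0"
      using pos \<open>d \<noteq> 0\<close> by (simp add: t_def divide_neg_pos flip: power2_eq_square)
    ultimately show False by simp
  qed
  with \<open>y \<in> M\<close> that show thesis by blast
qed

section \<open>Complex subspaces, adjoints and projections\<close>

lemma csubspace_imp_subspace: "csubspace M \<Longrightarrow> subspace (M :: 'a::complex_hilbert_space set)"
  by (auto simp: csubspace_def subspace_def scaleR_scaleC)

lemma bounded_linear_scaleC: "bounded_linear (\<lambda>x::'a::complex_hilbert_space. c *\<^sub>C x)"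
  by (rule clinear_bounded_linear[where C = "cmod c"])
    (auto intro!: clinearI simp: scaleC_add_right scaleC_scaleC mult.commute norm_scaleC)

lemma csubspace_closure:
  fixes G :: "'a::complex_hilbert_space set"
  assumes "csubspace G"
  shows "csubspace (closure G)"
  unfolding csubspace_def
proof (intro conjI ballI allI)
  show "0 \<in> closure G"
    using assms closure_subset by (auto simp: csubspace_def)
next
  fix x y assume "x \<in> closure G" "y \<in> closure G"
  then obtain f g where "\<And>n. f n \<in> G" "f \<longlonglongrightarrow> x" "\<And>n. g n \<in> G" "g \<longlonglongrightarrow> y"
    unfolding closure_sequential by blast
  then have "(\<forall>n. f n + g n \<in> G) \<and> (\<lambda>n. f n + g n) \<longlonglongrightarrow> x + y"
    using assms by (auto simp: csubspace_def intro: tendsto_add)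
  then show "x + y \<in> closure G"
    unfolding closure_sequential by (rule exI[of _ "\<lambda>n. f n + g n"])
next
  fix c x assume "x \<in> closure G"
  then obtain f where "\<And>n. f n \<in> G" "f \<longlonglongrightarrow> x"
    unfolding closure_sequential by blast
  then have "(\<forall>n. c *\<^sub>C f n \<in> G) \<and> (\<lambda>n. c *\<^sub>C f n) \<longlonglongrightarrow> c *\<^sub>C x"
    using assms bounded_linear.tendsto[OF bounded_linear_scaleC] by (auto simp: csubspace_def)
  then show "c *\<^sub>C x \<in> closure G"
    unfolding closure_sequential by (rule exI[of _ "\<lambda>n. c *\<^sub>C f n"])
qed

lemma Im_cinner: "Im (cinner x y) = - inner (\<i> *\<^sub>C x) (y::'a::complex_hilbert_space)"
  by (simp add: inner_cinner cinner_scaleC_left)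

text \<open>The Riesz theorem for the real functional \<open>inner (T x) y\<close> yields the real
  part of the identity. Testing it at \<open>\<i> *\<^sub>C x\<close> yields the imaginary part, by
  complex linearity of T.\<close>

lemma adjoint_exists:
  fixes T :: "'a::complex_hilbert_space \<Rightarrow> 'b::complex_hilbert_space"
  assumes "clinear T" and "bounded_linear T"
  obtains T' where "clinear T'" and "\<And>x y. cinner (T x) y = cinner x (T' y)"
proof -
  have "\<exists>z. \<forall>x. cinner (T x) y = cinner x z" for y
  proof -
    have "bounded_linear (\<lambda>x. inner (T x) y)"
      using bounded_linear_compose[OF bounded_linear_inner_left assms(2)] .
    then obtain z where z: "\<And>x. inner z x = inner (T x) y"
      using representer_on_closed_subspace[of UNIV "\<lambda>x. inner (T x) y"] by auto
    have "cinner (T x) y = cinner x z" for x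
      using z[of x] z[of "\<i> *\<^sub>C x"]
      by (simp add: complex_eq_iff Im_cinner clinear_scaleC[OF assms(1)] inner_commute
          flip: inner_cinner)
    then show ?thesis by blast
  qed
  then obtain T' where T': "\<And>x y. cinner (T x) y = cinner x (T' y)" by metis
  then have T'': "cinner (T' y) x = cinner y (T x)" for x y
    by (metis cinner_commute)
  have "clinear T'"
    by (rule clinearI; rule cinner_eqI) (simp_all add: T'' cinner_simps)
  with T' that show thesis by blast
qed

text \<open>The middle property is uniqueness in the form of a rule for computing
  \<open>P x\<close>; linearity and idempotence are later read off from it.\<close>

lemma projection_exists:
  fixes M :: "'a::complex_hilbert_space set"
  assumes "closed M" and "csubspace M"
  obtains P where "\<And>x. P x \<in> M"
    and "\<And>x y. y \<in> M \<Longrightarrow> (\<And>z. z \<in> M \<Longrightarrow> cinner y z = cinner x z) \<Longrightarrow> P x = y"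
    and "\<And>x z. z \<in> M \<Longrightarrow> cinner (P x) z = cinner x z"
proof -
  have "\<exists>y\<in>M. \<forall>z\<in>M. cinner y z = cinner x z" for x
  proof -
    obtain y where "y \<in> M" and y: "\<And>z. z \<in> M \<Longrightarrow> inner y z = inner x z"
      using representer_on_closed_subspace[OF assms(1) csubspace_imp_subspace[OF assms(2)]
          bounded_linear_inner_right[of x]] by blast
    then show ?thesis
      using assms(2) unfolding csubspace_def by (metis cinner_conv_inner)
  qed
  then obtain P where P: "\<And>x. P x \<in> M" "\<And>x z. z \<in> M \<Longrightarrow> cinner (P x) z = cinner x z"
    by metis
  have "P x = y" if "y \<in> M" and "\<And>z. z \<in> M \<Longrightarrow> cinner y z = cinner x z" for x y
  proof -
    have "P x - y \<in> M"
      using subspace_diff[OF csubspace_imp_subspace[OF assms(2)]] P(1) that(1) by blast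
    then have "cinner (P x - y) (P x - y) = 0"
      by (simp add: cinner_diff_left P(2) that(2))
    then show ?thesis by (simp add: cinner_self)
  qed
  with P that show thesis by blast
qed

text \<open>The reflection in the closed graph of \<open>a h \<mapsto> b h\<close> sends \<open>(a h, 0)\<close> to \<open>(0, b h)\<close>,
  because \<open>(a h, b h)\<close> lies in the graph and \<open>(a h, - b h)\<close> is orthogonal to it.\<close>

lemma unitary_intertwining_gram:
  fixes a b :: "'a::complex_hilbert_space \<Rightarrow> 'e::complex_hilbert_space"
  assumes "clinear a" and "clinear b"
    and gram: "\<And>h k. cinner (a h) (a k) = cinner (b h) (b k)"
  obtains W :: "'e \<times> 'e \<Rightarrow> 'e \<times> 'e"
    where "unitary W" and "\<And>h. W (a h, 0) = (b h, 0)"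
proof -
  define G where "G = range (\<lambda>h. (a h, b h))"
  define N where "N = closure G"
  have "csubspace G"
    unfolding csubspace_def
  proof (intro conjI ballI allI)
    have "(a 0, b 0) \<in> G" by (simp add: G_def)
    then show "0 \<in> G" by (simp add: clinear_zero assms zero_prod_def)
  next
    fix x y assume "x \<in> G" "y \<in> G"
    then obtain h k where "x = (a h, b h)" "y = (a k, b k)" by (auto simp: G_def)
    then have "x + y = (a (h + k), b (h + k))" by (simp add: clinear_add assms)
    then show "x + y \<in> G" by (simp add: G_def)
  next
    fix c x assume "x \<in> G"
    then obtain h where "x = (a h, b h)" by (auto simp: G_def)
    then have "c *\<^sub>C x = (a (c *\<^sub>C h), b (c *\<^sub>C h))" by (simp add: clinear_scaleC assms)
    then show "c *\<^sub>C x \<in> G" by (simp add: G_def)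
  qed
  then have "csubspace N"
    unfolding N_def by (rule csubspace_closure)
  moreover have "closed N" by (simp add: N_def)
  ultimately obtain P where PN: "\<And>x. P x \<in> N"
    and uniq: "\<And>x y. y \<in> N \<Longrightarrow> (\<And>z. z \<in> N \<Longrightarrow> cinner y z = cinner x z) \<Longrightarrow> P x = y"
    and P: "\<And>x z. z \<in> N \<Longrightarrow> cinner (P x) z = cinner x z"
    using projection_exists by blast
  have "clinear P"
    using \<open>csubspace N\<close> PN
    by (intro clinearI uniq) (auto simp: csubspace_def cinner_simps P)
  note lin = clinear_add[OF this] clinear_diff[OF this] clinear_scaleC[OF this]
  \<comment> \<open>The reflection \<open>2 P - 1\<close>: self-inverse since P is idempotent, and
    isometric since P is moreover self-adjoint.\<close>
  define R where "R x = P x + P x - x" for x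
  have "P (P x) = P x" for x by (rule uniq[OF PN]) simp
  then have RR: "R (R x) = x" for x by (simp add: R_def lin)
  have P': "cinner z (P x) = cinner z x" if "z \<in> N" for x z
    using P[OF that] cinner_commute by metis
  have PP: "cinner x (P y) = cinner (P x) y" for x y
    using P[OF PN] P'[OF PN] by metis
  have "unitary R"
  proof (rule unitaryI[where V = R])
    show "clinear R"
      by (rule clinearI) (simp_all add: R_def lin scaleC_add_right scaleC_diff_right)
    show "cinner (R x) (R y) = cinner x y" for x y
      by (simp add: R_def cinner_simps PP lin \<open>\<And>x. P (P x) = P x\<close>)
  qed (rule RR)
  have R: "R (a h, 0) = (0, b h)" for h
  proof -
    have "(a h, b h) \<in> N"
      using closure_subset[of G] by (auto simp: N_def G_def)
    have gram': "inner (a h) (a k) = inner (b h) (b k)" for k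
      by (simp add: inner_cinner gram)
    have half: "P (a h, 0) = (1/2) *\<^sub>R (a h, b h)"
    proof (rule uniq)
      show "(1/2) *\<^sub>R (a h, b h) \<in> N"
        using \<open>(a h, b h) \<in> N\<close> \<open>csubspace N\<close> by (intro subspace_scale csubspace_imp_subspace)
      \<comment> \<open>On G this is the equality of Gram forms; both sides are continuous in z, so
        it extends to the closure.\<close>
      have "inner ((1/2) *\<^sub>R (a h, b h)) z = inner (a h, 0) z" if "z \<in> N" for z
      proof -
        have "closed {z. inner ((1/2) *\<^sub>R (a h, b h)) z = inner (a h, 0) z}"
          by (intro closed_Collect_eq continuous_intros)
        moreover have "G \<subseteq> {z. inner ((1/2) *\<^sub>R (a h, b h)) z = inner (a h, 0) z}"
          by (auto simp: G_def gram')
        ultimately show ?thesis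
          using that closure_minimal[of G] unfolding N_def by blast
      qed
      then show "cinner ((1/2) *\<^sub>R (a h, b h)) z = cinner (a h, 0) z" if "z \<in> N" for z
        using that \<open>csubspace N\<close> unfolding csubspace_def by (metis cinner_conv_inner)
    qed
    show ?thesis by (simp add: R_def half scaleR_left.add[symmetric])
  qed
  show thesis
  proof
    show "unitary (prod.swap \<circ> R)"
      by (intro unitary_compose \<open>unitary R\<close> unitary_swap)
    show "(prod.swap \<circ> R) (a h, 0) = (b h, 0)" for h by (simp add: R)
  qed
qed

section \<open>The Julia operator\<close>

text \<open>A fixed point B of the iteration satisfies \<open>2 B = A + B B\<close>, that is,
  \<open>(1 - B) (1 - B) = 1 - A\<close>. This produces the square root of \<open>1 - A\<close>
  without spectral theory.\<close>

primrec sqrt_iter :: "('a::real_normed_vector \<Rightarrow>\<^sub>L 'a) \<Rightarrow> nat \<Rightarrow> ('a \<Rightarrow>\<^sub>L 'a)" where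
  "sqrt_iter A 0 = 0"
| "sqrt_iter A (Suc n) = (1/2) *\<^sub>R (A + (sqrt_iter A n o\<^sub>L sqrt_iter A n))"

text \<open>A majorant of \<^const>\<open>sqrt_iter\<close>, obtained for the scalar \<open>A = 1\<close>.\<close>

primrec sqrt_iter_bound :: "nat \<Rightarrow> real" where
  "sqrt_iter_bound 0 = 0"
| "sqrt_iter_bound (Suc n) = (1 + (sqrt_iter_bound n)\<^sup>2) / 2"

lemma sqrt_iter_bound_range: "0 \<le> sqrt_iter_bound n \<and> sqrt_iter_bound n \<le> 1"
  by (induction n) (auto simp: power_le_one)

lemma convergent_sqrt_iter_bound: "convergent sqrt_iter_bound"
proof -
  have "sqrt_iter_bound n \<le> sqrt_iter_bound (Suc n)" for n
    using zero_le_power2[of "1 - sqrt_iter_bound n"] by (simp add: power2_diff)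
  then have "incseq sqrt_iter_bound" by (rule incseq_SucI)
  then show ?thesis
    using sqrt_iter_bound_range by (metis incseq_convergent convergentI)
qed

text \<open>With D the difference of consecutive iterates, the next difference is half of
  \<open>B (Suc n) D + D B n\<close>, an identity that uses no commutativity. Hence the increments
  are dominated by those of the scalar iteration, whose sums telescope to a convergent
  sequence.\<close>

lemma convergent_sqrt_iter:
  fixes A :: "'a::banach \<Rightarrow>\<^sub>L 'a"
  assumes "norm A \<le> 1"
  shows "convergent (sqrt_iter A)"
proof -
  let ?B = "sqrt_iter A" and ?b = sqrt_iter_bound
  interpret comp: bounded_bilinear "(o\<^sub>L) :: ('a \<Rightarrow>\<^sub>L 'a) \<Rightarrow> ('a \<Rightarrow>\<^sub>L 'a) \<Rightarrow> ('a \<Rightarrow>\<^sub>L 'a)"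
    by (rule bounded_bilinear_blinfun_compose)
  have bound: "norm (?B n) \<le> ?b n" for n
  proof (induction n)
    case (Suc n)
    have "norm (?B n o\<^sub>L ?B n) \<le> (?b n)\<^sup>2"
      using norm_blinfun_compose[of "?B n" "?B n"] mult_mono[OF Suc Suc]
        sqrt_iter_bound_range[of n] by (simp add: power2_eq_square)
    then have "norm (A + (?B n o\<^sub>L ?B n)) \<le> 1 + (?b n)\<^sup>2"
      using norm_triangle_ineq[of A "?B n o\<^sub>L ?B n"] assms by linarith
    then show ?case by simp
  qed simp
  have step: "norm (?B (Suc n) - ?B n) \<le> ?b (Suc n) - ?b n" for n
  proof (induction n)
    case 0
    then show ?case using assms by simp
  next
    case (Suc n)
    let ?D = "?B (Suc n) - ?B n" and ?d = "?b (Suc n) - ?b n"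
    have "?B (Suc (Suc n)) - ?B (Suc n) = (1/2) *\<^sub>R ((?B (Suc n) o\<^sub>L ?D) + (?D o\<^sub>L ?B n))"
    proof -
      have "(?B (Suc n) o\<^sub>L ?D) + (?D o\<^sub>L ?B n) = (?B (Suc n) o\<^sub>L ?B (Suc n)) - (?B n o\<^sub>L ?B n)"
        by (simp only: comp.diff_left comp.diff_right) simp
      then show ?thesis
        by (simp only: sqrt_iter.simps(2)[of A "Suc n"])
          (simp only: sqrt_iter.simps(2)[of A n] scaleR_diff_right scaleR_add_right, simp)
    qed
    moreover have "norm (?B (Suc n) o\<^sub>L ?D) \<le> ?b (Suc n) * ?d"
      using norm_blinfun_compose[of "?B (Suc n)" ?D] mult_mono[OF bound[of "Suc n"] Suc]
        sqrt_iter_bound_range[of "Suc n"] norm_ge_zero[of ?D] by linarith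
    moreover have "norm (?D o\<^sub>L ?B n) \<le> ?d * ?b n"
    proof -
      have "0 \<le> ?d" using Suc norm_ge_zero order_trans by blast
      then show ?thesis
        using norm_blinfun_compose[of ?D "?B n"] mult_mono[OF Suc bound[of n]]
          norm_ge_zero[of "?B n"] by linarith
    qed
    ultimately have "norm (?B (Suc (Suc n)) - ?B (Suc n)) \<le> (?b (Suc n) * ?d + ?d * ?b n) / 2"
      using norm_triangle_ineq[of "?B (Suc n) o\<^sub>L ?D" "?D o\<^sub>L ?B n"] by simp
    also have "\<dots> = ?b (Suc (Suc n)) - ?b (Suc n)"
      by (simp only: sqrt_iter_bound.simps(2)[of "Suc n"] sqrt_iter_bound.simps(2)[of n])
        (simp add: field_simps power2_eq_square)
    finally show ?case .
  qed
  have diff: "norm (?B (n + k) - ?B n) \<le> ?b (n + k) - ?b n" for n k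
  proof (induction k)
    case (Suc k)
    then show ?case
      using step[of "n + k"] norm_triangle_ineq[of "?B (n + Suc k) - ?B (n + k)" "?B (n + k) - ?B n"]
      by (simp del: sqrt_iter.simps sqrt_iter_bound.simps)
  qed simp
  have "Cauchy ?B"
    unfolding Cauchy_altdef dist_norm
  proof (intro allI impI)
    fix e :: real assume "0 < e"
    then obtain N where N: "\<And>m n. m \<ge> N \<Longrightarrow> n \<ge> N \<Longrightarrow> norm (?b m - ?b n) < e"
      using convergent_Cauchy[OF convergent_sqrt_iter_bound] unfolding Cauchy_def dist_norm by blast
    have "norm (?B m - ?B n) < e" if "m \<ge> N" "n > m" for m n
      using diff[of m "n - m"] N[of n m] that by (simp add: norm_minus_commute)
    then show "\<exists>N. \<forall>m\<ge>N. \<forall>n>m. norm (?B m - ?B n) < e" by blast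
  qed
  then show ?thesis by (rule Cauchy_convergent)
qed

definition sqrt_one_minus :: "('a::banach \<Rightarrow>\<^sub>L 'a) \<Rightarrow> 'a \<Rightarrow> 'a" where
  "sqrt_one_minus A x = x - lim (sqrt_iter A) x"

lemma sqrt_iter_tendsto:
  fixes A :: "'a::banach \<Rightarrow>\<^sub>L 'a"
  assumes "norm A \<le> 1"
  shows "(\<lambda>n. x - sqrt_iter A n x) \<longlonglongrightarrow> sqrt_one_minus A x"
  unfolding sqrt_one_minus_def
  using convergent_sqrt_iter[OF assms]
  by (intro tendsto_intros) (auto simp: convergent_LIMSEQ_iff)

lemma sqrt_one_minus_square:
  fixes A :: "'a::banach \<Rightarrow>\<^sub>L 'a"
  assumes "norm A \<le> 1"
  shows "sqrt_one_minus A (sqrt_one_minus A x) = x - A x"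
proof -
  let ?L = "lim (sqrt_iter A)"
  have lim: "sqrt_iter A \<longlonglongrightarrow> ?L"
    using convergent_sqrt_iter[OF assms] by (simp add: convergent_LIMSEQ_iff)
  then have "(\<lambda>n. sqrt_iter A (Suc n)) \<longlonglongrightarrow> (1/2) *\<^sub>R (A + (?L o\<^sub>L ?L))"
    unfolding sqrt_iter.simps
    by (intro tendsto_intros bounded_bilinear.tendsto[OF bounded_bilinear_blinfun_compose])
  with LIMSEQ_Suc[OF lim] have "?L = (1/2) *\<^sub>R (A + (?L o\<^sub>L ?L))"
    by (rule LIMSEQ_unique)
  then have "2 *\<^sub>R ?L = A + (?L o\<^sub>L ?L)"
    by (metis (no_types) scaleR_scaleR scaleR_one mult.commute nonzero_mult_div_cancel_left
        times_divide_eq_right zero_neq_numeral)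
  then have "blinfun_apply (2 *\<^sub>R ?L) x = blinfun_apply (A + (?L o\<^sub>L ?L)) x"
    by (rule arg_cong)
  then have "2 *\<^sub>R ?L x = A x + ?L (?L x)"
    by (simp only: blinfun.add_left blinfun.scaleR_left blinfun_apply_blinfun_compose)
  then have "A x = ?L x + ?L x - ?L (?L x)" by (simp add: scaleR_2)
  then show ?thesis
    by (simp add: sqrt_one_minus_def blinfun.diff_right)
qed

text \<open>T passes through every iterate and, by continuity, through the limit. As T is only real
  linear here, the lemma serves twice: for scalar multiplication it gives complex linearity of the
  root, and for a contraction it links the two defect operators.\<close>

lemma sqrt_one_minus_intertwine:
  fixes A :: "'a::banach \<Rightarrow>\<^sub>L 'a" and B :: "'b::banach \<Rightarrow>\<^sub>L 'b"
  assumes "norm A \<le> 1" and "norm B \<le> 1" and "bounded_linear T" and "\<And>x. T (A x) = B (T x)"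
  shows "T (sqrt_one_minus A x) = sqrt_one_minus B (T x)"
proof (rule LIMSEQ_unique)
  interpret T: bounded_linear T by fact
  have iter: "T (sqrt_iter A n x) = sqrt_iter B n (T x)" for n x
    by (induction n arbitrary: x)
      (simp_all add: blinfun.scaleR_left blinfun.add_left T.add T.scaleR T.zero assms(4))
  show "(\<lambda>n. T (x - sqrt_iter A n x)) \<longlonglongrightarrow> T (sqrt_one_minus A x)"
    by (intro T.tendsto sqrt_iter_tendsto assms)
  show "(\<lambda>n. T (x - sqrt_iter A n x)) \<longlonglongrightarrow> sqrt_one_minus B (T x)"
    using sqrt_iter_tendsto[OF assms(2), of "T x"] by (simp add: T.diff iter)
qed

lemma sqrt_one_minus_clinear:
  fixes A :: "'a::complex_hilbert_space \<Rightarrow>\<^sub>L 'a"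
  assumes "norm A \<le> 1" and "clinear A"
  shows "clinear (sqrt_one_minus A)"
proof (rule clinearI)
  show "sqrt_one_minus A (x + y) = sqrt_one_minus A x + sqrt_one_minus A y" for x y
    by (simp add: sqrt_one_minus_def blinfun.add_right)
  show "sqrt_one_minus A (c *\<^sub>C x) = c *\<^sub>C sqrt_one_minus A x" for c x
    using sqrt_one_minus_intertwine[OF assms(1) assms(1) bounded_linear_scaleC[of c]]
    by (simp add: clinear_scaleC[OF assms(2)])
qed

lemma continuous_cinner_left: "continuous_on UNIV (\<lambda>x::'a::complex_hilbert_space. cinner x y)"
  and continuous_cinner_right: "continuous_on UNIV (\<lambda>x::'a::complex_hilbert_space. cinner y x)"
  unfolding cinner_conv_inner Complex_eq
  by (intro continuous_intros linear_continuous_on bounded_linear_scaleC)+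

lemma sqrt_one_minus_selfadjoint:
  fixes A :: "'a::complex_hilbert_space \<Rightarrow>\<^sub>L 'a"
  assumes "norm A \<le> 1" and "\<And>x y. cinner (A x) y = cinner x (A y)"
  shows "cinner (sqrt_one_minus A x) y = cinner x (sqrt_one_minus A y)"
proof (rule LIMSEQ_unique)
  have iter: "cinner (sqrt_iter A n x) y = cinner x (sqrt_iter A n y)" for n x y
  proof (induction n arbitrary: x y)
    case (Suc n)
    show ?case
      by (simp only: sqrt_iter.simps blinfun.scaleR_left blinfun.add_left
          blinfun_apply_blinfun_compose scaleR_scaleC cinner_simps assms(2) Suc
          complex_cnj_complex_of_real)
  qed simp
  show "(\<lambda>n. cinner (x - sqrt_iter A n x) y) \<longlonglongrightarrow> cinner (sqrt_one_minus A x) y"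
    by (rule continuous_on_tendsto_compose[OF continuous_cinner_left sqrt_iter_tendsto])
      (simp_all add: assms)
  have "(\<lambda>n. cinner x (y - sqrt_iter A n y)) \<longlonglongrightarrow> cinner x (sqrt_one_minus A y)"
    by (rule continuous_on_tendsto_compose[OF continuous_cinner_right sqrt_iter_tendsto])
      (simp_all add: assms)
  then show "(\<lambda>n. cinner (x - sqrt_iter A n x) y) \<longlonglongrightarrow> cinner x (sqrt_one_minus A y)"
    by (simp add: cinner_simps iter)
qed

text \<open>J is the block matrix with rows \<open>(T, E)\<close> and \<open>(D, - T')\<close>,
  where D and E are the defect operators, the roots of \<open>1 - T' T\<close> and
  \<open>1 - T T'\<close>. Its adjoint V is also its inverse: the diagonal entries of the products
  are the squares of the roots, and the others cancel by \<open>T D = E T\<close> and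
  \<open>T' E = D T'\<close>.\<close>

lemma julia_operator:
  fixes T :: "'a::complex_hilbert_space \<Rightarrow> 'a"
  assumes "clinear T" and contr: "\<And>x. norm (T x) \<le> norm x"
  obtains J :: "'a \<times> 'a \<Rightarrow> 'a \<times> 'a" where "unitary J" and "\<And>h. fst (J (h, 0)) = T h"
proof -
  have "bounded_linear T"
    using clinear_bounded_linear[OF assms(1), of 1] contr by simp
  then obtain T' where "clinear T'" and adj: "\<And>x y. cinner (T x) y = cinner x (T' y)"
    using adjoint_exists assms(1) by blast
  have adj': "cinner (T' x) y = cinner x (T y)" for x y
    using adj cinner_commute by metis
  have contr': "norm (T' x) \<le> norm x" for x
  proof -
    have "(norm (T' x))\<^sup>2 = inner (T (T' x)) x"
      by (simp add: power2_norm_eq_inner inner_cinner adj)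
    also have "\<dots> \<le> norm (T (T' x)) * norm x" by (rule norm_cauchy_schwarz)
    also have "\<dots> \<le> norm (T' x) * norm x" by (intro mult_right_mono contr) simp
    finally show ?thesis
      by (cases "norm (T' x) = 0") (auto simp: power2_eq_square)
  qed
  have "bounded_linear T'"
    using clinear_bounded_linear[OF \<open>clinear T'\<close>, of 1] contr' by simp
  define A where "A = Blinfun (T' \<circ> T)"
  define B where "B = Blinfun (T \<circ> T')"
  have A: "blinfun_apply A = T' \<circ> T" and B: "blinfun_apply B = T \<circ> T'"
    unfolding A_def B_def comp_def
    using bounded_linear_compose[OF \<open>bounded_linear T'\<close> \<open>bounded_linear T\<close>]
      bounded_linear_compose[OF \<open>bounded_linear T\<close> \<open>bounded_linear T'\<close>]
    by (simp_all add: bounded_linear_Blinfun_apply)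
  have "norm A \<le> 1" and "norm B \<le> 1"
    by (rule norm_blinfun_bound; simp add: A B order_trans[OF contr contr']
        order_trans[OF contr' contr])+
  define D where "D = sqrt_one_minus A"
  define E where "E = sqrt_one_minus B"
  have "clinear D" and "clinear E"
    unfolding D_def E_def
    by (intro sqrt_one_minus_clinear \<open>norm A \<le> 1\<close> \<open>norm B \<le> 1\<close>;
        simp add: A B clinear_compose \<open>clinear T\<close> \<open>clinear T'\<close>)+
  note lin = clinear_add[OF \<open>clinear T\<close>] clinear_add[OF \<open>clinear T'\<close>]
    clinear_add[OF \<open>clinear D\<close>] clinear_add[OF \<open>clinear E\<close>]
    clinear_diff[OF \<open>clinear T\<close>] clinear_diff[OF \<open>clinear T'\<close>]
    clinear_diff[OF \<open>clinear D\<close>] clinear_diff[OF \<open>clinear E\<close>]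
    clinear_scaleC[OF \<open>clinear T\<close>] clinear_scaleC[OF \<open>clinear T'\<close>]
    clinear_scaleC[OF \<open>clinear D\<close>] clinear_scaleC[OF \<open>clinear E\<close>]
  have sq: "D (D x) = x - T' (T x)" "E (E x) = x - T (T' x)" for x
    unfolding D_def E_def
    by (simp_all add: sqrt_one_minus_square \<open>norm A \<le> 1\<close> \<open>norm B \<le> 1\<close> A B)
  have sa: "cinner (D x) y = cinner x (D y)" "cinner (E x) y = cinner x (E y)" for x y
    unfolding D_def E_def
    by (intro sqrt_one_minus_selfadjoint \<open>norm A \<le> 1\<close> \<open>norm B \<le> 1\<close>; simp add: A B adj adj')+
  have TD: "T (D x) = E (T x)" for x
    unfolding D_def E_def
    by (rule sqrt_one_minus_intertwine) (simp_all add: A B \<open>norm A \<le> 1\<close> \<open>norm B \<le> 1\<close> \<open>bounded_linear T\<close>)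
  have TE: "T' (E x) = D (T' x)" for x
    unfolding D_def E_def
    by (rule sqrt_one_minus_intertwine) (simp_all add: A B \<open>norm A \<le> 1\<close> \<open>norm B \<le> 1\<close> \<open>bounded_linear T'\<close>)
  define J where "J x = (T (fst x) + E (snd x), D (fst x) - T' (snd x))" for x
  define V where "V x = (T' (fst x) + D (snd x), E (fst x) - T (snd x))" for x
  have "J (V x) = x" and VJ: "V (J x) = x" for x
    by (simp_all add: J_def V_def lin sq TD TE prod_eq_iff)
  have JV: "cinner (J x) y = cinner x (V y)" for x y
    by (simp add: J_def V_def cinner_prod_def cinner_simps adj adj' sa)
  have "unitary J"
  proof (rule unitaryI[where V = V])
    show "clinear J"
      by (rule clinearI) (simp_all add: J_def lin scaleC_add_right scaleC_diff_right)
  qed (simp_all add: JV VJ \<open>\<And>x. J (V x) = x\<close>)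
  moreover have "fst (J (h, 0)) = T h" for h
    by (simp add: J_def clinear_zero[OF \<open>clinear E\<close>])
  ultimately show thesis by (rule that)
qed

section \<open>Unitaries on direct sums\<close>

lemma unitary_map_prod:
  assumes "unitary U" and "unitary V"
  shows "unitary (map_prod U V)"
proof (rule unitaryI[where V = "map_prod (inv U) (inv V)"])
  show "clinear (map_prod U V)"
    using unitary_clinear[OF assms(1)] unitary_clinear[OF assms(2)]
    by (intro clinearI) (auto simp: prod_eq_iff clinear_add clinear_scaleC)
qed (auto simp: assms cinner_prod_def unitary_cinner map_prod_def split: prod.splits)

lemma unitary_id: "unitary id"
  by (rule unitaryI[where V = id]) (auto intro: clinearI)

definition pad :: "('a \<times> 'e \<Rightarrow> 'a \<times> 'e) \<Rightarrow> 'a \<times> 'e \<times> 'f \<Rightarrow> 'a \<times> 'e \<times> 'f" where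
  "pad g = (\<lambda>(h, e, f). (fst (g (h, e)), snd (g (h, e)), f))"

lemma pad_simp: "pad g (h, e, f) = (fst (g (h, e)), snd (g (h, e)), f)"
  by (simp add: pad_def)

lemma pad_compose: "pad g \<circ> pad g' = pad (g \<circ> g')"
  by (auto simp: pad_def fun_eq_iff)

lemma pad_map_prod_id: "pad (map_prod Q id) = map_prod Q id"
  by (auto simp: pad_def fun_eq_iff)

lemma unitary_pad:
  assumes "unitary g"
  shows "unitary (pad g)"
proof (rule unitaryI[where V = "pad (inv g)"])
  note lin = unitary_clinear[OF assms]
  show "clinear (pad g)"
  proof (rule clinearI)
    show "pad g (x + y) = pad g x + pad g y" for x y
      using clinear_add[OF lin, of "(fst x, fst (snd x))" "(fst y, fst (snd y))"]
      by (simp add: pad_def split_beta prod_eq_iff)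
    show "pad g (c *\<^sub>C x) = c *\<^sub>C pad g x" for c x
      using clinear_scaleC[OF lin, of c "(fst x, fst (snd x))"]
      by (simp add: pad_def split_beta prod_eq_iff)
  qed
  show "cinner (pad g x) (pad g y) = cinner x y" for x y
    using unitary_cinner[OF assms, of "(fst x, fst (snd x))" "(fst y, fst (snd y))"]
    by (simp add: pad_def split_beta cinner_prod_def)
qed (auto simp: pad_def assms)

text \<open>\<open>X (0, x)\<close> is orthogonal to every \<open>X (z, 0) = (z, 0)\<close>, so its
  first component vanishes and X is block diagonal. Surjectivity of W is inherited from X.\<close>

lemma unitary_fixing_left:
  fixes X :: "'a::complex_hilbert_space \<times> 'b::complex_hilbert_space \<Rightarrow> 'a \<times> 'b"
  assumes "unitary X" and fixed: "\<And>h. X (h, 0) = (h, 0)"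
  obtains W where "unitary W" and "\<And>h x. X (h, x) = (h, W x)"
proof -
  note lin = unitary_clinear[OF assms(1)]
  have "fst (X (0, x)) = 0" for x
  proof (rule cinner_eqI)
    fix z
    have "cinner (X (0, x)) (X (z, 0)) = cinner (0, x) (z, 0)"
      by (rule unitary_cinner[OF assms(1)])
    then show "cinner (fst (X (0, x))) z = cinner 0 z"
      by (simp add: fixed cinner_prod_def)
  qed
  define W where "W x = snd (X (0, x))" for x
  have X0: "X (0, x) = (0, W x)" for x
    using \<open>fst (X (0, x)) = 0\<close> by (simp add: W_def prod_eq_iff)
  have X: "X (h, x) = (h, W x)" for h x
    using clinear_add[OF lin, of "(h, 0)" "(0, x)"] by (simp add: fixed X0)
  have "unitary W"
  proof (rule unitaryI[where V = "\<lambda>x. snd (inv X (0, x))"])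
    show "clinear W"
    proof (rule clinearI)
      show "W (x + y) = W x + W y" for x y
        using clinear_add[OF lin, of "(0, x)" "(0, y)"] by (simp add: X0)
      show "W (c *\<^sub>C x) = c *\<^sub>C W x" for c x
        using clinear_scaleC[OF lin, of c "(0, x)"] by (simp add: X0)
    qed
    show "cinner (W x) (W y) = cinner x y" for x y
      using unitary_cinner[OF assms(1), of "(0, x)" "(0, y)"] by (simp add: X0 cinner_prod_def)
    show "W (snd (inv X (0, x))) = x" for x
    proof -
      obtain h y where y: "inv X (0, x) = (h, y)" by (cases "inv X (0, x)")
      then have "X (h, y) = (0, x)" using unitary_inv_right[OF assms(1)] by metis
      then show ?thesis by (simp add: y X)
    qed
  qed
  with X that show thesis by blast
qed

text \<open>Two unitaries \<open>g\<close>, \<open>g'\<close> on \<open>H \<times> E\<close> with the same corner on \<open>H\<close> have adjoints whose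
  components \<open>H \<rightarrow> E\<close> have equal Gram forms. A unitary \<open>W\<close> carrying one component to
  the other exists after padding with a copy of \<open>E\<close>; then \<open>g' (1 \<oplus> W) g\<^sup>-\<^sup>1\<close> fixes \<open>H\<close> pointwise.\<close>

lemma unitaries_with_equal_corner:
  fixes g g' :: "'a::complex_hilbert_space \<times> 'e::complex_hilbert_space \<Rightarrow> 'a \<times> 'e"
  assumes "unitary g" and "unitary g'" and corner: "\<And>h. fst (g (h, 0)) = fst (g' (h, 0))"
  obtains W W' :: "'e \<times> 'e \<Rightarrow> 'e \<times> 'e" where "unitary W" and "unitary W'"
    and "\<And>h x. pad g' (h, W x) = map_prod id W' (pad g (h, x))"
proof -
  define t where "t h = fst (inv g (h, 0))" for h
  define a where "a h = snd (inv g (h, 0))" for h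
  define b where "b h = snd (inv g' (h, 0))" for h
  have g: "inv g (h, 0) = (t h, a h)" for h by (simp add: t_def a_def)
  \<comment> \<open>The corner of the inverse is the adjoint of the corner. Hence the inverses of g
    and g' have the same component t on H, and removing it from the inner products leaves equal Gram
    forms for a and b.\<close>
  have inv_corner: "cinner (fst (inv u (h, 0))) k = cinner h (fst (u (k, 0)))"
    if "unitary u" for u :: "'a \<times> 'e \<Rightarrow> 'a \<times> 'e" and h k
    using unitary_cinner[OF that, of "inv u (h, 0)" "(k, 0)"] that by (simp add: cinner_prod_def)
  have g': "inv g' (h, 0) = (t h, b h)" for h
  proof -
    have "fst (inv g' (h, 0)) = t h"
      by (rule cinner_eqI) (simp add: t_def inv_corner assms)
    then show ?thesis by (simp add: b_def prod_eq_iff)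
  qed
  note lin = unitary_clinear[OF unitary_inv[OF assms(1)]]
    unitary_clinear[OF unitary_inv[OF assms(2)]]
  have "clinear a"
  proof (rule clinearI)
    show "a (x + y) = a x + a y" for x y
      using clinear_add[OF lin(1), of "(x, 0)" "(y, 0)"] by (simp add: a_def)
    show "a (c *\<^sub>C x) = c *\<^sub>C a x" for c x
      using clinear_scaleC[OF lin(1), of c "(x, 0)"] by (simp add: a_def)
  qed
  moreover have "clinear b"
  proof (rule clinearI)
    show "b (x + y) = b x + b y" for x y
      using clinear_add[OF lin(2), of "(x, 0)" "(y, 0)"] by (simp add: b_def)
    show "b (c *\<^sub>C x) = c *\<^sub>C b x" for c x
      using clinear_scaleC[OF lin(2), of c "(x, 0)"] by (simp add: b_def)
  qed
  moreover have "cinner (a h) (a k) = cinner (b h) (b k)" for h k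
  proof -
    have "cinner (inv g (h, 0)) (inv g (k, 0)) = cinner (inv g' (h, 0)) (inv g' (k, 0))"
      by (simp add: unitary_cinner unitary_inv assms)
    then show ?thesis by (simp add: g g' cinner_prod_def)
  qed
  ultimately obtain W :: "'e \<times> 'e \<Rightarrow> 'e \<times> 'e"
    where "unitary W" and W: "\<And>h. W (a h, 0) = (b h, 0)"
    using unitary_intertwining_gram by blast
  \<comment> \<open>The vector \<open>(h, 0)\<close> travels through \<open>(t h, a h, 0)\<close>
    and \<open>(t h, b h, 0)\<close> back to \<open>(h, 0)\<close>.\<close>
  define X where "X = pad g' \<circ> map_prod id W \<circ> inv (pad g)"
  have "unitary X"
    unfolding X_def
    by (intro unitary_compose unitary_inv unitary_pad unitary_map_prod unitary_id assms \<open>unitary W\<close>)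
  moreover have "X (h, 0) = (h, 0)" for h
  proof -
    have "g (t h, a h) = (h, 0)" using g unitary_inv_right[OF assms(1)] by metis
    then have "pad g (t h, a h, 0 :: 'e) = (h, 0)" by (simp add: pad_simp zero_prod_def)
    then have "inv (pad g) (h, 0) = (t h, a h, 0 :: 'e)"
      using unitary_inv_left[OF unitary_pad[OF assms(1)], of "(t h, a h, 0 :: 'e)"] by simp
    moreover have "g' (t h, b h) = (h, 0)" using g' unitary_inv_right[OF assms(2)] by metis
    ultimately show ?thesis by (simp add: X_def W pad_simp zero_prod_def)
  qed
  ultimately obtain W' where "unitary W'" and W': "\<And>h x. X (h, x) = (h, W' x)"
    using unitary_fixing_left by blast
  have "pad g' (h, W x) = map_prod id W' (pad g (h, x))" for h x
  proof -
    have "X (pad g (h, x)) = pad g' (h, W x)"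
      by (simp add: X_def unitary_pad assms)
    then show ?thesis using W' by (cases "pad g (h, x)") simp
  qed
  with \<open>unitary W\<close> \<open>unitary W'\<close> that show thesis by blast
qed

section \<open>Operators on square-summable families\<close>

text \<open>Meaningful only if the image family is square-summable; \<open>coord_l2_map\<close>
  secures this when no component increases the norm.\<close>

definition l2_map :: "('i \<Rightarrow> 'a \<Rightarrow> 'b) \<Rightarrow> ('i, 'a::complex_hilbert_space) l2 \<Rightarrow>
    ('i, 'b::complex_hilbert_space) l2" where
  "l2_map f x = Abs_l2 (\<lambda>n. f n (coord x n))"

lemma coord_l2_map:
  assumes "\<And>n u. norm (f n u) \<le> norm u"
  shows "coord (l2_map f x) n = f n (coord x n)"
proof -
  have "(\<lambda>n. (norm (f n (coord x n)))\<^sup>2) summable_on UNIV"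
    by (rule summable_on_comparison_test[OF summable_norm_sq[of x]]) (auto intro: power_mono assms)
  then show ?thesis by (simp add: l2_map_def Abs_l2_inverse)
qed

lemma coord_l2_map_unitary:
  "(\<And>n. unitary (W n)) \<Longrightarrow> coord (l2_map W x) n = W n (coord x n)"
  by (simp add: coord_l2_map unitary_norm)

lemma unitary_l2_map:
  assumes "\<And>n. unitary (W n)"
  shows "unitary (l2_map W)"
proof (rule unitaryI[where V = "l2_map (\<lambda>n. inv (W n))"])
  note coord = coord_l2_map_unitary[of W, OF assms]
    coord_l2_map_unitary[of "\<lambda>n. inv (W n)", OF unitary_inv[OF assms]]
  show "clinear (l2_map W)"
    by (rule clinearI; rule l2_eqI)
      (simp_all add: coord clinear_add[OF unitary_clinear[OF assms]]
        clinear_scaleC[OF unitary_clinear[OF assms]])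
  show "l2_map W (l2_map (\<lambda>n. inv (W n)) x) = x" for x
    by (rule l2_eqI) (simp add: coord assms)
  show "cinner (l2_map W x) (l2_map W y) = cinner x y" for x y
    by (simp add: cinner_l2_def coord unitary_cinner[OF assms])
qed

section \<open>Translations and partial shifts\<close>

lift_definition l2_translate ::
  "'i::group_add \<Rightarrow> ('i, 'a::complex_hilbert_space) l2 \<Rightarrow> ('i, 'a) l2" is "\<lambda>k x n. x (n - k)"
proof -
  fix k :: 'i and x :: "'i \<Rightarrow> 'a" assume "(\<lambda>n. (norm (x n))\<^sup>2) summable_on UNIV"
  moreover have "bij (\<lambda>n. n - k)" by (rule bij_betwI[where g = "\<lambda>n. n + k"]) auto
  ultimately show "(\<lambda>n. (norm (x (n - k)))\<^sup>2) summable_on UNIV"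
    using summable_on_reindex_bij_betw[of "\<lambda>n. n - k" UNIV UNIV "\<lambda>n. (norm (x n))\<^sup>2"] by simp
qed

lemmas coord_l2_translate [simp] = l2_translate.rep_eq

lemma cinner_l2_translate: "cinner (l2_translate k x) (l2_translate k y) = cinner x y"
proof -
  have "bij (\<lambda>n. n - k)" by (rule bij_betwI[where g = "\<lambda>n. n + k"]) auto
  then show ?thesis
    unfolding cinner_l2_def coord_l2_translate
    using infsum_reindex_bij_betw[of "\<lambda>n. n - k" UNIV UNIV "\<lambda>n. cinner (coord x n) (coord y n)"]
    by simp
qed

text \<open>A pair of orthogonal projections with sum 1, given by orthogonality of the ranges;
  idempotence is derived in \<open>complementary_mult\<close>.\<close>

definition complementary ::
    "('e::complex_hilbert_space \<Rightarrow> 'e) \<Rightarrow> ('e \<Rightarrow> 'e) \<Rightarrow> bool" where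
  "complementary p q \<longleftrightarrow> clinear p \<and> clinear q \<and> (\<forall>u. p u + q u = u) \<and>
     (\<forall>u v. cinner (p u) (q v) = 0)"

lemma complementary_sym: "complementary p q \<Longrightarrow> complementary q p"
  unfolding complementary_def by (metis add.commute cinner_commute complex_cnj_zero)

text \<open>Since p and q add up to the identity, they commute; so \<open>p (q u)\<close> lies in
  both ranges and is orthogonal to itself.\<close>

lemma complementary_mult:
  assumes "complementary p q"
  shows "p (q u) = 0" and "p (p u) = p u"
proof -
  have lin: "clinear p" "clinear q" and sum: "\<And>u. p u + q u = u"
    and orth: "\<And>u v. cinner (p u) (q v) = 0"
    using assms by (auto simp: complementary_def)
  have "p (q u) = q (p u)" for u
  proof -
    have "p (q u) = q u - q (q u)" using sum[of "q u"] by (simp add: eq_diff_eq)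
    also have "\<dots> = q (u - q u)" by (simp add: clinear_diff[OF lin(2)])
    also have "u - q u = p u" using sum[of u] by (simp add: diff_eq_eq)
    finally show ?thesis .
  qed
  then have "cinner (p (q u)) (p (q u)) = 0" for u by (metis orth)
  then show pq: "p (q u) = 0" for u by (simp add: cinner_self)
  show "p (p u) = p u"
    using arg_cong[OF sum[of u], of p] by (simp add: clinear_add[OF lin(1)] pq)
qed

lemma complementary_norm_le:
  assumes "complementary p q"
  shows "norm (p u) \<le> norm u"
proof -
  have "p u + q u = u" and "cinner (p u) (q u) = 0"
    using assms by (auto simp: complementary_def)
  then have "inner (p u) (q u) = 0" by (simp add: inner_cinner)
  have "(norm u)\<^sup>2 = (norm (p u))\<^sup>2 + (norm (q u))\<^sup>2"
    by (subst (1) \<open>p u + q u = u\<close>[symmetric])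
      (simp add: power2_norm_eq_inner inner_add_left inner_add_right inner_commute
        \<open>inner (p u) (q u) = 0\<close>)
  then have "(norm (p u))\<^sup>2 \<le> (norm u)\<^sup>2" by simp
  then show ?thesis by (rule power2_le_imp_le) simp
qed

text \<open>The bilateral shift on the range of p and the identity on the range of q. Exchanging p
  and q gives the complementary factor of the full shift.\<close>

definition partial_shift ::
    "('e \<Rightarrow> 'e) \<Rightarrow> ('e \<Rightarrow> 'e) \<Rightarrow> (int, 'e::complex_hilbert_space) l2 \<Rightarrow> (int, 'e) l2" where
  "partial_shift p q x = l2_translate 1 (l2_map (\<lambda>_. p) x) + l2_map (\<lambda>_. q) x"

lemma coord_partial_shift:
  assumes "complementary p q"
  shows "coord (partial_shift p q x) n = p (coord x (n - 1)) + q (coord x n)"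
  using complementary_norm_le[OF assms] complementary_norm_le[OF complementary_sym[OF assms]]
  by (simp add: partial_shift_def coord_l2_map)

lemma partial_shift_compose:
  assumes "complementary p q"
  shows "partial_shift p q (partial_shift q p x) = l2_translate 1 x"
proof (rule l2_eqI)
  fix n
  note pq = complementary_sym[OF assms]
  have "p u + q u = u" for u using assms by (simp add: complementary_def)
  moreover have "clinear p" "clinear q" using assms by (auto simp: complementary_def)
  ultimately show "coord (partial_shift p q (partial_shift q p x)) n = coord (l2_translate 1 x) n"
    by (simp add: coord_partial_shift assms pq clinear_add complementary_mult[OF assms]
        complementary_mult[OF pq])
qed

text \<open>The right inverse is the complementary partial shift followed by the backward
  translation, as \<open>partial_shift_compose\<close> suggests. Inner products are compared
  separately on the p part, which is translated, and on the q part, which stays.\<close>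

lemma unitary_partial_shift:
  assumes "complementary p q"
  shows "unitary (partial_shift p q)"
proof (rule unitaryI[where V = "\<lambda>x. l2_translate (- 1) (partial_shift q p x)"])
  note qp = complementary_sym[OF assms]
  have lin: "clinear p" "clinear q" and sum: "\<And>u. p u + q u = u"
    and orth: "\<And>u v. cinner (p u) (q v) = 0" "\<And>u v. cinner (q u) (p v) = 0"
    using assms qp by (auto simp: complementary_def)
  show "clinear (partial_shift p q)"
    by (rule clinearI; rule l2_eqI)
      (simp_all add: coord_partial_shift[OF assms] clinear_add[OF lin(1)] clinear_add[OF lin(2)]
        clinear_scaleC[OF lin(1)] clinear_scaleC[OF lin(2)] scaleC_add_right)
  show "partial_shift p q (l2_translate (- 1) (partial_shift q p x)) = x" for x
    by (rule l2_eqI)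
      (simp add: coord_partial_shift assms qp clinear_add lin sum complementary_mult[OF assms]
        complementary_mult[OF qp])
  show "cinner (partial_shift p q x) (partial_shift p q y) = cinner x y" for x y
  proof -
    let ?P = "l2_map (\<lambda>_. p) :: (int, 'a) l2 \<Rightarrow> _" and ?Q = "l2_map (\<lambda>_. q) :: (int, 'a) l2 \<Rightarrow> _"
    have coord: "coord (?P z) n = p (coord z n)" "coord (?Q z) n = q (coord z n)" for z n
      using complementary_norm_le[OF assms] complementary_norm_le[OF qp]
      by (simp_all add: coord_l2_map)
    have "x = ?P x + ?Q x" "y = ?P y + ?Q y"
      by (rule l2_eqI, simp add: coord sum)+
    then have "cinner x y = cinner (?P x + ?Q x) (?P y + ?Q y)" by metis
    also have "\<dots> = cinner (?P x) (?P y) + cinner (?Q x) (?Q y)"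
      unfolding cinner_simps by (simp add: cinner_l2_def coord orth)
    also have "\<dots> = cinner (partial_shift p q x) (partial_shift p q y)"
      unfolding partial_shift_def cinner_simps
      by (simp add: cinner_l2_translate) (simp add: cinner_l2_def coord orth)
    finally show ?thesis by simp
  qed
qed

section \<open>Unitaries coupled to a single coordinate\<close>

lift_definition l2_update :: "'i \<Rightarrow> 'a \<Rightarrow> ('i, 'a::complex_hilbert_space) l2 \<Rightarrow> ('i, 'a) l2"
  is "\<lambda>i u x. x(i := u)"
proof -
  fix i :: 'i and u :: 'a and x :: "'i \<Rightarrow> 'a"
  assume "(\<lambda>n. (norm (x n))\<^sup>2) summable_on UNIV"
  then have "(\<lambda>n. (norm (x n))\<^sup>2) summable_on (UNIV - {i})"
    by (rule summable_on_subset_banach) simp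
  then have "(\<lambda>n. (norm ((x(i := u)) n))\<^sup>2) summable_on (UNIV - {i})"
    by (rule summable_on_cong[THEN iffD1, rotated]) simp
  then have "(\<lambda>n. (norm ((x(i := u)) n))\<^sup>2) summable_on insert i (UNIV - {i})"
    by (simp only: summable_on_insert_iff)
  then show "(\<lambda>n. (norm ((x(i := u)) n))\<^sup>2) summable_on UNIV"
    by (simp add: insert_UNIV insert_Diff_if)
qed

lemmas coord_l2_update [simp] = l2_update.rep_eq

lemma cinner_l2_split:
  "cinner x y = cinner (coord x i) (coord y i) +
    (\<Sum>\<^sub>\<infinity>n\<in>UNIV - {i}. cinner (coord x n) (coord y n))"
proof -
  have "(\<lambda>n. cinner (coord x n) (coord y n)) summable_on (UNIV - {i})"
    by (rule summable_on_subset_banach[OF cinner_summable]) simp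
  then have "(\<Sum>\<^sub>\<infinity>n\<in>insert i (UNIV - {i}). cinner (coord x n) (coord y n)) =
      cinner (coord x i) (coord y i) + (\<Sum>\<^sub>\<infinity>n\<in>UNIV - {i}. cinner (coord x n) (coord y n))"
    by (rule infsum_insert) simp
  then show ?thesis by (simp add: cinner_l2_def insert_UNIV insert_Diff_if)
qed

lemma cinner_l2_update:
  "cinner (l2_update i u x) (l2_update i v y) =
    cinner u v + (\<Sum>\<^sub>\<infinity>n\<in>UNIV - {i}. cinner (coord x n) (coord y n))"
proof -
  have "(\<Sum>\<^sub>\<infinity>n\<in>UNIV - {i}. cinner (coord (l2_update i u x) n) (coord (l2_update i v y) n)) =
      (\<Sum>\<^sub>\<infinity>n\<in>UNIV - {i}. cinner (coord x n) (coord y n))"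
    by (rule infsum_cong) simp
  then show ?thesis by (subst cinner_l2_split[of _ _ i]) (simp only:, simp)
qed

text \<open>H meets the sequence only at coordinate 0; a following shift brings coordinate -1 there
  and carries the output on to coordinate 1.\<close>

definition act_at_zero :: "('a \<times> 'e \<Rightarrow> 'a \<times> 'e) \<Rightarrow>
    'a \<times> (int, 'e::complex_hilbert_space) l2 \<Rightarrow> 'a \<times> (int, 'e) l2" where
  "act_at_zero g = (\<lambda>(h, x). (fst (g (h, coord x 0)), l2_update 0 (snd (g (h, coord x 0))) x))"

lemma act_at_zero_simp:
  "act_at_zero g (h, x) = (fst (g (h, coord x 0)), l2_update 0 (snd (g (h, coord x 0))) x)"
  by (simp add: act_at_zero_def)

lemma act_at_zero_compose: "act_at_zero g \<circ> act_at_zero g' = act_at_zero (g \<circ> g')"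
  by (auto simp: act_at_zero_simp fun_eq_iff intro: l2_eqI)

lemma act_at_zero_map_prod_id: "act_at_zero (map_prod Q id) = map_prod Q id"
  by (auto simp: act_at_zero_simp fun_eq_iff intro: l2_eqI)

lemma unitary_act_at_zero:
  assumes "unitary g"
  shows "unitary (act_at_zero g)"
proof (rule unitaryI[where V = "act_at_zero (inv g)"])
  note lin = unitary_clinear[OF assms]
  show "clinear (act_at_zero g)"
  proof (rule clinearI)
    show "act_at_zero g (x + y) = act_at_zero g x + act_at_zero g y" for x y
      using clinear_add[OF lin, of "(fst x, coord (snd x) 0)" "(fst y, coord (snd y) 0)"]
      by (auto simp: act_at_zero_def split_beta prod_eq_iff intro: l2_eqI)
    show "act_at_zero g (c *\<^sub>C x) = c *\<^sub>C act_at_zero g x" for c x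
      using clinear_scaleC[OF lin, of c "(fst x, coord (snd x) 0)"]
      by (auto simp: act_at_zero_def split_beta prod_eq_iff intro: l2_eqI)
  qed
  show "act_at_zero g (act_at_zero (inv g) x) = x" for x
    by (auto simp: act_at_zero_def split_beta prod_eq_iff assms intro: l2_eqI)
  show "cinner (act_at_zero g x) (act_at_zero g y) = cinner x y" for x y
    using unitary_cinner[OF assms, of "(fst x, coord (snd x) 0)" "(fst y, coord (snd y) 0)"]
    by (simp add: act_at_zero_def split_beta cinner_prod_def cinner_l2_update
        cinner_l2_split[of "snd x" "snd y" 0])
qed

text \<open>For complementary p and q, one equation says two things: g leaves the q part unchanged,
  and its other outputs do not depend on that part.\<close>

definition supported_on :: "('e::complex_hilbert_space \<Rightarrow> 'e) \<Rightarrow> ('e \<Rightarrow> 'e) \<Rightarrow>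
    ('a \<times> 'e \<Rightarrow> 'a \<times> 'e) \<Rightarrow> bool" where
  "supported_on p q g \<longleftrightarrow> (\<forall>h u v. g (h, p u + q v) = (fst (g (h, u)), p (snd (g (h, u))) + q v))"

lemma supported_onD:
  assumes "complementary p q" and "supported_on p q g"
  shows "q (snd (g (h, u))) = q u"
proof -
  have "p u + q u = u" and "clinear q"
    using assms(1) by (auto simp: complementary_def)
  then have "g (h, u) = (fst (g (h, u)), p (snd (g (h, u))) + q u)"
    using assms(2) unfolding supported_on_def by metis
  then have "q (snd (g (h, u))) = q (p (snd (g (h, u))) + q u)"
    by (metis snd_conv)
  also have "\<dots> = q u"
    by (simp add: clinear_add[OF \<open>clinear q\<close>] complementary_mult[OF complementary_sym[OF assms(1)]])
  finally show ?thesis .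
qed

text \<open>The two maps work on different slots: g sees only the p part of coordinate 0, while
  \<open>partial_shift q p\<close> moves only q parts.\<close>

lemma act_at_zero_partial_shift:
  fixes g :: "'a \<times> 'e::complex_hilbert_space \<Rightarrow> 'a \<times> 'e"
  assumes "complementary p q" and "supported_on p q g"
  shows "act_at_zero g \<circ> map_prod id (partial_shift q p) = map_prod id (partial_shift q p) \<circ> act_at_zero g"
proof (rule ext, rule prod_eqI)
  fix k :: "'a \<times> (int, 'e) l2"
  obtain h x where k: "k = (h, x)" by (cases k)
  note qp = complementary_sym[OF assms(1)]
  have g: "g (h, q v + p u) = (fst (g (h, u)), p (snd (g (h, u))) + q v)"
    "g (h, p u + q v) = (fst (g (h, u)), p (snd (g (h, u))) + q v)" for h u v
    using assms(2) by (simp_all add: supported_on_def add.commute[of "q v"])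
  show "fst ((act_at_zero g \<circ> map_prod id (partial_shift q p)) k) =
      fst ((map_prod id (partial_shift q p) \<circ> act_at_zero g) k)"
    by (simp add: k act_at_zero_simp coord_partial_shift[OF qp] g)
  show "snd ((act_at_zero g \<circ> map_prod id (partial_shift q p)) k) =
      snd ((map_prod id (partial_shift q p) \<circ> act_at_zero g) k)"
    by (rule l2_eqI)
      (auto simp: k act_at_zero_simp coord_partial_shift[OF qp] g supported_onD[OF assms] add.commute)
qed

section \<open>The dilation\<close>

text \<open>Index 0 is included among the vanishing coordinates, so that the unitary acting there
  receives \<open>(h, 0)\<close> and its H component is exactly the corner.\<close>

definition forward :: "'a \<times> (int, 'e::complex_hilbert_space) l2 \<Rightarrow> bool" where
  "forward k \<longleftrightarrow> (\<forall>n\<le>0. coord (snd k) n = 0)"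

text \<open>After g acts, coordinate 0 has a possibly nonzero p part, which the shift moves to index
  1; its q part is still 0 by \<open>supported_onD\<close>.\<close>

lemma forward_shift_act:
  assumes "complementary p q" and "supported_on p q g" and "forward k"
  defines "V \<equiv> map_prod id (partial_shift p q) \<circ> act_at_zero g"
  shows "forward (V k)" and "fst (V k) = fst (g (fst k, 0))"
proof -
  obtain h x where k: "k = (h, x)" by (cases k)
  have x: "coord x n = 0" if "n \<le> 0" for n
    using assms(3) that by (simp add: forward_def k)
  have "clinear p" "clinear q" using assms(1) by (auto simp: complementary_def)
  then show "forward (V k)"
    using x supported_onD[OF assms(1,2), of h 0]
    by (auto simp: forward_def V_def k act_at_zero_simp coord_partial_shift[OF assms(1)] clinear_zero)
  show "fst (V k) = fst (g (fst k, 0))"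
    by (simp add: V_def k act_at_zero_simp x)
qed

lemma forward_l2_map:
  assumes "\<And>n. unitary (W n)"
  shows "forward (map_prod id (l2_map W) k) \<longleftrightarrow> forward k"
proof -
  have "W n u = 0 \<longleftrightarrow> u = 0" for n u
    using unitary_norm[OF assms, of n u] by (metis norm_eq_zero)
  then show ?thesis by (simp add: forward_def coord_l2_map_unitary[OF assms])
qed

text \<open>Meant for A the forward vectors and f the component in H. Carrying the invariant A along
  allows the powers of \<open>U1\<close> to be treated after those of \<open>U2\<close>.\<close>

lemma funpow_semiconjugate:
  assumes "\<And>x. A x \<Longrightarrow> A (U x) \<and> f (U x) = T (f x)" and "A x"
  shows "A ((U ^^ n) x) \<and> f ((U ^^ n) x) = (T ^^ n) (f x)"
  using assms by (induction n) auto

text \<open>The shift moves index n - 1 to n, and the blocks at these two indices agree except for n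
  = 1. Precisely there the entry has passed through g, and the hypothesis exchanges W for
  W'.\<close>

lemma l2_map_translate_act_at_zero:
  fixes g g' :: "'a::complex_hilbert_space \<times> 'e::complex_hilbert_space \<Rightarrow> 'a \<times> 'e"
  assumes "unitary W" and "unitary W'"
    and g: "\<And>h u. g' (h, W u) = map_prod id W' (g (h, u))"
  defines "D \<equiv> (map_prod id :: _ \<Rightarrow> 'a \<times> _ \<Rightarrow> _) (l2_map (\<lambda>n::int. if n \<le> 0 then W else W'))"
  shows "D \<circ> (map_prod id (l2_translate 1) \<circ> act_at_zero g) =
    map_prod id (l2_translate 1) \<circ> act_at_zero g' \<circ> D"
proof (rule ext, rule prod_eqI)
  fix k :: "'a \<times> (int, 'e) l2"
  obtain h x where k: "k = (h, x)" by (cases k)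
  note coord = coord_l2_map_unitary[of "\<lambda>n::int. if n \<le> 0 then W else W'"]
  show "fst ((D \<circ> (map_prod id (l2_translate 1) \<circ> act_at_zero g)) k) =
    fst ((map_prod id (l2_translate 1) \<circ> act_at_zero g' \<circ> D) k)"
    by (simp add: k D_def act_at_zero_simp coord assms(1,2) g)
  show "snd ((D \<circ> (map_prod id (l2_translate 1) \<circ> act_at_zero g)) k) =
    snd ((map_prod id (l2_translate 1) \<circ> act_at_zero g' \<circ> D) k)"
    by (rule l2_eqI) (auto simp: k D_def act_at_zero_simp coord assms(1,2) g)
qed

lemma q_commuting_dilation:
  fixes Q T1 T2 :: "'a::complex_hilbert_space \<Rightarrow> 'a"
  assumes "unitary Q"
    and T1: "clinear T1" "\<And>x. norm (T1 x) \<le> norm x"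
    and T2: "clinear T2" "\<And>x. norm (T2 x) \<le> norm x"
    and comm: "(\<forall>x. T1 (T2 x) = Q (T2 (T1 x))) \<or> (\<forall>x. T1 (T2 x) = T2 (Q (T1 x))) \<or>
      (\<forall>x. T1 (T2 x) = T2 (T1 (Q x)))"
  obtains U1 U2 :: "'a \<times> (int, ('a \<times> 'a) \<times> ('a \<times> 'a)) l2 \<Rightarrow> 'a \<times> (int, ('a \<times> 'a) \<times> ('a \<times> 'a)) l2"
  where "unitary U1" and "unitary U2"
    and "(\<forall>x. U1 (U2 x) = map_prod Q id (U2 (U1 x))) \<or>
      (\<forall>x. U1 (U2 x) = U2 (map_prod Q id (U1 x))) \<or>
      (\<forall>x. U1 (U2 x) = U2 (U1 (map_prod Q id x)))"
    and "\<And>k1 k2 h. fst ((U1 ^^ k1) ((U2 ^^ k2) (h, 0))) = (T1 ^^ k1) ((T2 ^^ k2) h)"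
proof -
  obtain J1 :: "'a \<times> 'a \<Rightarrow> 'a \<times> 'a" where "unitary J1" and J1: "\<And>h. fst (J1 (h, 0)) = T1 h"
    using julia_operator[OF T1] by blast
  obtain J2 :: "'a \<times> 'a \<Rightarrow> 'a \<times> 'a" where "unitary J2" and J2: "\<And>h. fst (J2 (h, 0)) = T2 h"
    using julia_operator[OF T2] by blast
  define sw where "sw = (map_prod id prod.swap :: 'a \<times> 'a \<times> 'a \<Rightarrow> _)"
  define G1 where "G1 = (pad J1 :: 'a \<times> 'a \<times> 'a \<Rightarrow> _)"
  \<comment> \<open>Conjugation by the swap lets J2 use the second defect slot, whereas G1 uses the
    first.\<close>
  define G2 where "G2 = sw \<circ> pad J2 \<circ> sw"
  define R where "R = (map_prod Q id :: 'a \<times> 'a \<times> 'a \<Rightarrow> _)"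
  have G1: "G1 (h, u) = (fst (J1 (h, fst u)), snd (J1 (h, fst u)), snd u)" for h u
    by (simp add: G1_def pad_def split_beta)
  have G2: "G2 (h, u) = (fst (J2 (h, snd u)), fst u, snd (J2 (h, snd u)))" for h u
    by (simp add: G2_def sw_def pad_def split_beta)
  have "unitary G1" "unitary G2" "unitary R"
    unfolding G1_def G2_def sw_def R_def
    by (intro unitary_compose unitary_pad unitary_map_prod unitary_id unitary_swap assms
        \<open>unitary J1\<close> \<open>unitary J2\<close>)+
  \<comment> \<open>The first defect slot and both padding slots travel with \<open>V1\<close>, the
    second defect slot with \<open>V2\<close>; together they make up the full shift.\<close>
  define p q :: "('a \<times> 'a) \<times> ('a \<times> 'a) \<Rightarrow> ('a \<times> 'a) \<times> ('a \<times> 'a)"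
    where "p u = ((fst (fst u), 0), snd u)" and "q u = ((0, snd (fst u)), 0)" for u
  have pq: "complementary p q"
    by (auto simp: complementary_def p_def q_def prod_eq_iff cinner_prod_def intro!: clinearI)
  then have qp: "complementary q p" by (rule complementary_sym)
  have supp1: "supported_on p q (pad G1)" and supp2: "supported_on q p (pad G2)"
    by (auto simp: supported_on_def p_def q_def pad_simp G1 G2)
  define Sp where "Sp = (map_prod id (partial_shift p q) :: 'a \<times> _ \<Rightarrow> _)"
  define Sq where "Sq = (map_prod id (partial_shift q p) :: 'a \<times> _ \<Rightarrow> _)"
  define S where "S = (map_prod id (l2_translate 1) :: 'a \<times> (int, ('a \<times> 'a) \<times> ('a \<times> 'a)) l2 \<Rightarrow> _)"
  define Q' where "Q' = (map_prod Q id :: 'a \<times> (int, ('a \<times> 'a) \<times> ('a \<times> 'a)) l2 \<Rightarrow> _)"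
  define L1 where "L1 = (act_at_zero (pad G1) :: _ \<times> (int, _ \<times> ('a \<times> 'a)) l2 \<Rightarrow> _)"
  define L2 where "L2 = (act_at_zero (pad G2) :: _ \<times> (int, _ \<times> ('a \<times> 'a)) l2 \<Rightarrow> _)"
  define V1 where "V1 = Sp \<circ> L1"
  define V2 where "V2 = Sq \<circ> L2"
  have "unitary V1" "unitary V2"
    unfolding V1_def V2_def Sp_def Sq_def L1_def L2_def
    by (intro unitary_compose unitary_map_prod unitary_id unitary_partial_shift unitary_act_at_zero
        unitary_pad pq qp \<open>unitary G1\<close> \<open>unitary G2\<close>)+
  have SpSq: "Sp (Sq x) = S x" and SqSp: "Sq (Sp x) = S x" for x
    by (simp_all add: Sp_def Sq_def S_def prod_eq_iff partial_shift_compose pq qp)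
  have L1: "L1 (Sq x) = Sq (L1 x)" and L2: "L2 (Sp x) = Sp (L2 x)" for x
    using act_at_zero_partial_shift[OF pq supp1] act_at_zero_partial_shift[OF qp supp2]
    unfolding L1_def L2_def Sp_def Sq_def by (metis comp_apply)+
  have Q'S: "Q' (S x) = S (Q' x)" "Q' (Sp x) = Sp (Q' x)" "Q' (Sq x) = Sq (Q' x)" for x
    by (simp_all add: Q'_def S_def Sp_def Sq_def prod_eq_iff)
  have Q': "Q' = act_at_zero (pad R)"
    by (simp add: Q'_def R_def pad_map_prod_id act_at_zero_map_prod_id)
  have V12: "V1 \<circ> V2 = S \<circ> act_at_zero (pad (G1 \<circ> G2))"
  proof -
    have "V1 \<circ> V2 = S \<circ> (L1 \<circ> L2)"
      by (simp add: fun_eq_iff V1_def V2_def L1 SpSq)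
    then show ?thesis by (simp only: L1_def L2_def act_at_zero_compose pad_compose)
  qed
  have V21: "Q' \<circ> V2 \<circ> V1 = S \<circ> act_at_zero (pad (R \<circ> G2 \<circ> G1))"
    "V2 \<circ> Q' \<circ> V1 = S \<circ> act_at_zero (pad (G2 \<circ> R \<circ> G1))"
    "V2 \<circ> V1 \<circ> Q' = S \<circ> act_at_zero (pad (G2 \<circ> G1 \<circ> R))"
  proof -
    have "Q' \<circ> V2 \<circ> V1 = S \<circ> (Q' \<circ> L2 \<circ> L1)" "V2 \<circ> Q' \<circ> V1 = S \<circ> (L2 \<circ> Q' \<circ> L1)"
      "V2 \<circ> V1 \<circ> Q' = S \<circ> (L2 \<circ> L1 \<circ> Q')"
      by (simp_all add: fun_eq_iff V1_def V2_def L2 Q'S SqSp)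
    then show "Q' \<circ> V2 \<circ> V1 = S \<circ> act_at_zero (pad (R \<circ> G2 \<circ> G1))"
      "V2 \<circ> Q' \<circ> V1 = S \<circ> act_at_zero (pad (G2 \<circ> R \<circ> G1))"
      "V2 \<circ> V1 \<circ> Q' = S \<circ> act_at_zero (pad (G2 \<circ> G1 \<circ> R))"
      by (simp_all only: Q' L1_def L2_def act_at_zero_compose pad_compose)
  qed
  have corner: "fst ((G1 \<circ> G2) (h, 0)) = T1 (T2 h)" "fst ((R \<circ> G2 \<circ> G1) (h, 0)) = Q (T2 (T1 h))"
    "fst ((G2 \<circ> R \<circ> G1) (h, 0)) = T2 (Q (T1 h))" "fst ((G2 \<circ> G1 \<circ> R) (h, 0)) = T2 (T1 (Q h))" for h
    by (simp_all add: G1 G2 R_def J1 J2)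
  \<comment> \<open>The product in the other order, with R placed where the given relation places Q.
    Its corner is \<open>T1 T2\<close> by that relation, and from here on the three forms are
    treated alike.\<close>
  obtain g' :: "'a \<times> 'a \<times> 'a \<Rightarrow> 'a \<times> 'a \<times> 'a"
    where "unitary g'" and corner': "\<And>h. fst ((G1 \<circ> G2) (h, 0)) = fst (g' (h, 0))"
    and g': "S \<circ> act_at_zero (pad g') = Q' \<circ> V2 \<circ> V1 \<or> S \<circ> act_at_zero (pad g') = V2 \<circ> Q' \<circ> V1 \<or>
      S \<circ> act_at_zero (pad g') = V2 \<circ> V1 \<circ> Q'"
  proof -
    have u: "unitary (R \<circ> G2 \<circ> G1)" "unitary (G2 \<circ> R \<circ> G1)" "unitary (G2 \<circ> G1 \<circ> R)"
      by (intro unitary_compose \<open>unitary G1\<close> \<open>unitary G2\<close> \<open>unitary R\<close>)+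
    from comm show thesis
    proof (elim disjE)
      assume *: "\<forall>x. T1 (T2 x) = Q (T2 (T1 x))"
      show thesis by (rule that[OF u(1)]) (simp_all only: corner * V21 simp_thms)
    next
      assume *: "\<forall>x. T1 (T2 x) = T2 (Q (T1 x))"
      show thesis by (rule that[OF u(2)]) (simp_all only: corner * V21 simp_thms)
    next
      assume *: "\<forall>x. T1 (T2 x) = T2 (T1 (Q x))"
      show thesis by (rule that[OF u(3)]) (simp_all only: corner * V21 simp_thms)
    qed
  qed
  obtain W W' :: "('a \<times> 'a) \<times> ('a \<times> 'a) \<Rightarrow> ('a \<times> 'a) \<times> ('a \<times> 'a)"
    where "unitary W" "unitary W'"
    and WW': "\<And>h x. pad g' (h, W x) = map_prod id W' (pad (G1 \<circ> G2) (h, x))"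
    by (rule unitaries_with_equal_corner[OF unitary_compose[OF \<open>unitary G1\<close> \<open>unitary G2\<close>]
          \<open>unitary g'\<close> corner']) (rule that)
  define w where "w n = (if n \<le> 0 then W else W')" for n :: int
  have w: "unitary (w n)" for n by (simp add: w_def \<open>unitary W\<close> \<open>unitary W'\<close>)
  define D where "D = (map_prod id (l2_map w) :: 'a \<times> _ \<Rightarrow> _)"
  have "unitary D" unfolding D_def by (intro unitary_map_prod unitary_id unitary_l2_map w)
  have D: "D \<circ> (V1 \<circ> V2) = S \<circ> act_at_zero (pad g') \<circ> D"
    unfolding V12 D_def S_def w_def
    by (rule l2_map_translate_act_at_zero) (rule \<open>unitary W\<close> \<open>unitary W'\<close> WW')+
  define U1 where "U1 = D \<circ> V1"
  define U2 where "U2 = V2 \<circ> inv D"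
  have U1: "forward (U1 k) \<and> fst (U1 k) = T1 (fst k)" if "forward k" for k
    using forward_shift_act[OF pq supp1 that]
    by (simp add: forward_l2_map[of w, OF w] U1_def D_def V1_def Sp_def L1_def pad_simp zero_prod_def G1 J1)
  have U2: "forward (U2 k) \<and> fst (U2 k) = T2 (fst k)" if "forward k" for k
  proof -
    define k' where "k' = inv D k"
    have "D k' = k" by (simp add: k'_def \<open>unitary D\<close>)
    then have "fst k' = fst k" and "forward k'"
      using that forward_l2_map[of w k', OF w] by (auto simp: D_def)
    then show ?thesis
      using forward_shift_act[OF qp supp2 \<open>forward k'\<close>]
      by (simp add: U2_def V2_def Sq_def L2_def pad_simp zero_prod_def G2 J2 flip: k'_def)
  qed
  show thesis
  proof
    show "unitary U1" "unitary U2"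
      unfolding U1_def U2_def
      by (intro unitary_compose unitary_inv \<open>unitary D\<close> \<open>unitary V1\<close> \<open>unitary V2\<close>)+
    \<comment> \<open>D is the identity on H and Q' is the identity on the sequences. Their
      commuting matters for the form with Q in the middle, where Q' stands between the inverse of D
      and D.\<close>
    have "D (Q' x) = Q' (D x)" for x by (simp add: D_def Q'_def prod_eq_iff)
    then have inv_D: "inv D (Q' (D x)) = Q' x" for x by (metis \<open>unitary D\<close> unitary_inv_left)
    have "U1 (U2 x) = (S \<circ> act_at_zero (pad g')) x" for x
      using fun_cong[OF D, of "inv D x"] by (simp add: U1_def U2_def \<open>unitary D\<close>)
    moreover have "Q' (U2 (U1 x)) = (Q' \<circ> V2 \<circ> V1) x" "U2 (Q' (U1 x)) = (V2 \<circ> Q' \<circ> V1) x"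
      "U2 (U1 (Q' x)) = (V2 \<circ> V1 \<circ> Q') x" for x
      by (simp_all add: U1_def U2_def \<open>unitary D\<close> inv_D)
    ultimately show "(\<forall>x. U1 (U2 x) = map_prod Q id (U2 (U1 x))) \<or>
      (\<forall>x. U1 (U2 x) = U2 (map_prod Q id (U1 x))) \<or>
      (\<forall>x. U1 (U2 x) = U2 (U1 (map_prod Q id x)))"
      using g' unfolding Q'_def[symmetric] by presburger
    show "fst ((U1 ^^ k1) ((U2 ^^ k2) (h, 0))) = (T1 ^^ k1) ((T2 ^^ k2) h)" for k1 k2 h
    proof -
      have "forward (h, 0 :: (int, ('a \<times> 'a) \<times> ('a \<times> 'a)) l2)" by (simp add: forward_def)
      note * = funpow_semiconjugate[of forward U2 fst T2 "(h, 0)" k2, OF U2 this]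
      with funpow_semiconjugate[of forward U1 fst T1 "(U2 ^^ k2) (h, 0)" k1, OF U1]
      show ?thesis by simp
    qed
  qed
qed

section \<open>Transport to sequences\<close>

text \<open>Off the range of \<Phi> the value of \<open>inv \<Phi>\<close> is arbitrary, which is
  harmless because the carrier is that range.\<close>

definition pulled_cinner ::
    "('k::complex_hilbert_space \<Rightarrow> 'v::complex_vector) \<Rightarrow> 'v \<Rightarrow> 'v \<Rightarrow> complex" where
  "pulled_cinner \<Phi> x y = cinner (inv \<Phi> x) (inv \<Phi> y)"

definition conjugated :: "('k \<Rightarrow> 'v) \<Rightarrow> ('k \<Rightarrow> 'k) \<Rightarrow> 'v \<Rightarrow> 'v" where
  "conjugated \<Phi> U x = \<Phi> (U (inv \<Phi> x))"

context
  fixes \<Phi> :: "'k::complex_hilbert_space \<Rightarrow> 'v::complex_vector"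
  assumes lin: "clinear \<Phi>" and inj: "inj \<Phi>"
begin

lemma pulled_cinner_apply: "pulled_cinner \<Phi> (\<Phi> x) (\<Phi> y) = cinner x y"
  by (simp add: pulled_cinner_def inj)

lemma hnorm_pulled_cinner: "hnorm (pulled_cinner \<Phi>) (\<Phi> x) = norm x"
  by (simp add: hnorm_def pulled_cinner_apply norm_eq_sqrt_inner inner_cinner)

lemma conjugated_apply: "conjugated \<Phi> U (\<Phi> x) = \<Phi> (U x)"
  by (simp add: conjugated_def inj)

lemma conjugated_funpow: "(conjugated \<Phi> U ^^ n) (\<Phi> x) = \<Phi> ((U ^^ n) x)"
  by (induction n) (simp_all add: conjugated_apply)

lemma csubspace_image:
  assumes "csubspace M"
  shows "csubspace (\<Phi> ` M)"
  unfolding csubspace_def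
proof (intro conjI ballI allI)
  show "0 \<in> \<Phi> ` M"
    using assms clinear_zero[OF lin] by (force simp: csubspace_def)
qed (use assms in \<open>auto simp: csubspace_def simp flip: clinear_add[OF lin] clinear_scaleC[OF lin]\<close>)

lemma hilbert_space_on_range: "hilbert_space_on (range \<Phi>) (pulled_cinner \<Phi>)"
proof
  show "csubspace (range \<Phi>)"
    by (rule csubspace_image) (simp add: csubspace_def)
next
  fix x assume "x \<in> range \<Phi>" "x \<noteq> 0"
  then obtain a where "x = \<Phi> a" "a \<noteq> 0" using clinear_zero[OF lin] by auto
  then show "0 < Re (pulled_cinner \<Phi> x x)"
    by (simp add: pulled_cinner_apply flip: inner_cinner)
next
  fix \<sigma> :: "nat \<Rightarrow> 'v"
  assume "\<And>n. \<sigma> n \<in> range \<Phi>"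
    and cauchy: "\<And>e. 0 < e \<Longrightarrow> \<exists>N. \<forall>m\<ge>N. \<forall>n\<ge>N. hnorm (pulled_cinner \<Phi>) (\<sigma> m - \<sigma> n) < e"
  then have "\<forall>n. \<exists>a. \<sigma> n = \<Phi> a" by blast
  then obtain s where s: "\<And>n. \<sigma> n = \<Phi> (s n)" by metis
  have "Cauchy s"
    using cauchy
    by (simp add: Cauchy_def dist_norm s hnorm_pulled_cinner flip: clinear_diff[OF lin])
  then obtain a where "s \<longlonglongrightarrow> a"
    using Cauchy_convergent convergent_def by blast
  then have "(\<lambda>n. hnorm (pulled_cinner \<Phi>) (\<sigma> n - \<Phi> a)) \<longlonglongrightarrow> 0"
    by (simp add: s hnorm_pulled_cinner LIM_zero tendsto_norm_zero flip: clinear_diff[OF lin])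
  then show "\<exists>x\<in>range \<Phi>. (\<lambda>n. hnorm (pulled_cinner \<Phi>) (\<sigma> n - x)) \<longlonglongrightarrow> 0"
    by blast
qed (auto simp: pulled_cinner_apply cinner_add_left cinner_scaleC_left
    simp flip: clinear_add[OF lin] clinear_scaleC[OF lin] intro: cinner_commute)

lemma bounded_operator_conjugated:
  assumes "clinear U" and "\<And>x. norm (U x) \<le> norm x"
  shows "bounded_operator (range \<Phi>) (pulled_cinner \<Phi>) (conjugated \<Phi> U)"
  unfolding bounded_operator_def
proof (intro conjI exI[of _ 1])
  show "clinear_on (range \<Phi>) (conjugated \<Phi> U)"
    by (auto simp: clinear_on_def conjugated_apply clinear_add[OF assms(1)]
        clinear_scaleC[OF assms(1)] simp flip: clinear_add[OF lin] clinear_scaleC[OF lin])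
qed (auto simp: conjugated_apply hnorm_pulled_cinner assms(2))

lemma is_adjoint_conjugated:
  assumes "clinear V" and "\<And>x. norm (V x) \<le> norm x" and "\<And>x y. cinner (U x) y = cinner x (V y)"
  shows "is_adjoint (range \<Phi>) (pulled_cinner \<Phi>) (conjugated \<Phi> U) (conjugated \<Phi> V)"
  unfolding is_adjoint_def
  using bounded_operator_conjugated[OF assms(1,2)]
  by (auto simp: conjugated_apply pulled_cinner_apply assms(3))

lemma is_adjoint_conjugated_unitary:
  assumes "unitary U"
  shows "is_adjoint (range \<Phi>) (pulled_cinner \<Phi>) (conjugated \<Phi> U) (conjugated \<Phi> (inv U))"
  by (rule is_adjoint_conjugated)
    (simp_all add: unitary_clinear unitary_inv unitary_norm unitary_adjoint assms)

lemma unitary_operator_conjugated: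
  assumes "unitary U"
  shows "unitary_operator (range \<Phi>) (pulled_cinner \<Phi>) (conjugated \<Phi> U)"
  unfolding unitary_operator_def
proof (intro conjI exI)
  show "bounded_operator (range \<Phi>) (pulled_cinner \<Phi>) (conjugated \<Phi> U)"
    by (rule bounded_operator_conjugated) (simp_all add: assms unitary_clinear unitary_norm)
  show "is_adjoint (range \<Phi>) (pulled_cinner \<Phi>) (conjugated \<Phi> U) (conjugated \<Phi> (inv U))"
    by (rule is_adjoint_conjugated_unitary[OF assms])
qed (auto simp: conjugated_apply assms)

end

text \<open>Entry 0 holds the H component. The other entries list all components of all coordinates,
  which are countably many: i is the index, b selects the defect pair or the padding pair, and c the
  member of that pair.\<close>

definition to_sequence ::
    "'a::complex_hilbert_space \<times> (int, ('a \<times> 'a) \<times> ('a \<times> 'a)) l2 \<Rightarrow> nat \<Rightarrow> 'a" where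
  "to_sequence k n = (case n of 0 \<Rightarrow> fst k | Suc m \<Rightarrow>
     (case from_nat m of (i, b, c) \<Rightarrow>
       (if c then fst else snd) ((if b then fst else snd) (coord (snd k) i))))"

lemma clinear_to_sequence: "clinear to_sequence"
  by (rule clinearI)
    (auto simp: fun_eq_iff to_sequence_def scaleC_fun_def split: nat.split prod.split)

lemma inj_to_sequence: "inj to_sequence"
proof (rule injI)
  fix k l :: "'a \<times> (int, ('a \<times> 'a) \<times> ('a \<times> 'a)) l2"
  assume eq: "to_sequence k = to_sequence l"
  have "fst k = fst l" using fun_cong[OF eq, of 0] by (simp add: to_sequence_def)
  moreover have "(if c then fst else snd) ((if b then fst else snd) (coord (snd k) i)) =
      (if c then fst else snd) ((if b then fst else snd) (coord (snd l) i))" for i b c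
    using fun_cong[OF eq, of "Suc (to_nat (i, b, c))"] by (simp add: to_sequence_def)
  from this[of True True] this[of True False] this[of False True] this[of False False]
  have "snd k = snd l" by (intro l2_eqI) (simp add: prod_eq_iff)
  ultimately show "k = l" by (simp add: prod_eq_iff)
qed

section \<open>Unitaries and contractions on the given space\<close>

lemma unitary_operator_UNIV:
  fixes Q :: "'a::complex_hilbert_space \<Rightarrow> 'a"
  assumes "unitary_operator UNIV cinner Q"
  shows "unitary Q"
proof -
  obtain Q' where "clinear Q" and adj: "\<And>x y. cinner (Q x) y = cinner x (Q' y)"
    and "\<And>x. Q' (Q x) = x" and "\<And>x. Q (Q' x) = x"
    using assms by (auto simp: unitary_operator_def is_adjoint_def bounded_operator_def)
  then show ?thesis by (intro unitaryI[where V = Q']) auto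
qed

lemma contraction_UNIV:
  fixes T :: "'a::complex_hilbert_space \<Rightarrow> 'a"
  assumes "contraction UNIV cinner T"
  shows "clinear T" and "norm (T x) \<le> norm x"
proof -
  obtain C where lin: "clinear T" and C: "\<And>x. norm (T x) \<le> C * norm x"
    and sup: "(SUP x\<in>{x. norm x \<le> 1}. norm (T x)) \<le> 1"
    using assms by (auto simp: contraction_def bounded_operator_def op_norm_def hnorm_cinner)
  show "clinear T" by fact
  \<comment> \<open>The supremum is known to bound its members only once the set is bounded above;
    no sign of C is given, hence the absolute value.\<close>
  have "bdd_above ((\<lambda>x. norm (T x)) ` {x. norm x \<le> 1})"
  proof (rule bdd_aboveI2)
    fix x :: 'a assume "x \<in> {x. norm x \<le> 1}"
    then have "C * norm x \<le> \<bar>C\<bar> * 1" by (intro mult_mono) auto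
    then show "norm (T x) \<le> \<bar>C\<bar>" using C[of x] by simp
  qed
  then have unit: "norm (T y) \<le> 1" if "norm y \<le> 1" for y
    using cSUP_upper[of y "{x. norm x \<le> 1}" "\<lambda>x. norm (T x)"] sup that by simp
  show "norm (T x) \<le> norm x"
  proof (cases "x = 0")
    case False
    then have "norm (T (inverse (norm x) *\<^sub>R x)) \<le> 1" by (intro unit) simp
    with False show ?thesis by (simp add: clinear_scaleR[OF lin] field_simps)
  qed (simp add: clinear_zero[OF lin])
qed

theorem theorem2p5:
  fixes Q T1 T2 :: "'a::complex_hilbert_space \<Rightarrow> 'a"
  assumes "unitary_operator UNIV cinner Q"
    and "contraction UNIV cinner T1"
    and "contraction UNIV cinner T2"
    and "q_commuting UNIV cinner Q T1 T2"
  shows "\<exists>(K :: (nat \<Rightarrow> 'a) set) ip J U1 U2 Q' P.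
    hilbert_space_on K ip \<and>
    isometric_embedding J K ip \<and>
    unitary_operator K ip U1 \<and>
    unitary_operator K ip U2 \<and>
    unitary_operator K ip Q' \<and>
    q_commuting K ip Q' U1 U2 \<and>
    orthogonal_projection_onto K ip (range J) P \<and>
    (\<forall>k1 k2 h. J ((T1 ^^ k1) ((T2 ^^ k2) h)) = P ((U1 ^^ k1) ((U2 ^^ k2) (J h)))) \<and>
    reducing_subspace K ip (range J) Q' \<and>
    (\<forall>h. Q' (J h) = J (Q h))"
proof -
  have "unitary Q" using assms(1) by (rule unitary_operator_UNIV)
  have comm: "(\<forall>x. T1 (T2 x) = Q (T2 (T1 x))) \<or> (\<forall>x. T1 (T2 x) = T2 (Q (T1 x))) \<or>
      (\<forall>x. T1 (T2 x) = T2 (T1 (Q x)))"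
    using assms(4) by (simp add: q_commuting_def)
  obtain U1 U2 :: "'a \<times> (int, ('a \<times> 'a) \<times> ('a \<times> 'a)) l2 \<Rightarrow> 'a \<times> (int, ('a \<times> 'a) \<times> ('a \<times> 'a)) l2"
    where "unitary U1" "unitary U2"
    and U: "(\<forall>x. U1 (U2 x) = map_prod Q id (U2 (U1 x))) \<or>
      (\<forall>x. U1 (U2 x) = U2 (map_prod Q id (U1 x))) \<or>
      (\<forall>x. U1 (U2 x) = U2 (U1 (map_prod Q id x)))"
    and dil: "\<And>k1 k2 h. fst ((U1 ^^ k1) ((U2 ^^ k2) (h, 0))) = (T1 ^^ k1) ((T2 ^^ k2) h)"
    by (rule q_commuting_dilation[OF \<open>unitary Q\<close> contraction_UNIV[OF assms(2)]
        contraction_UNIV[OF assms(3)] comm]) (rule that)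
  define \<Phi> where "\<Phi> = (to_sequence :: 'a \<times> (int, ('a \<times> 'a) \<times> ('a \<times> 'a)) l2 \<Rightarrow> _)"
  define Q' where "Q' = (map_prod Q id :: 'a \<times> (int, ('a \<times> 'a) \<times> ('a \<times> 'a)) l2 \<Rightarrow> _)"
  define P where "P k = (fst k, 0 :: (int, ('a \<times> 'a) \<times> ('a \<times> 'a)) l2)"
    for k :: "'a \<times> (int, ('a \<times> 'a) \<times> ('a \<times> 'a)) l2"
  define J where "J h = \<Phi> (h, 0)" for h
  have lin: "clinear \<Phi>" and inj: "inj \<Phi>"
    by (simp_all add: \<Phi>_def clinear_to_sequence inj_to_sequence)
  note apply_simps = conjugated_apply[OF lin inj] pulled_cinner_apply[OF lin inj]
    conjugated_funpow[OF lin inj] hnorm_pulled_cinner[OF lin inj]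
  have "unitary Q'" unfolding Q'_def by (intro unitary_map_prod unitary_id \<open>unitary Q\<close>)
  let ?K = "range \<Phi>" and ?ip = "pulled_cinner \<Phi>"
  have J: "isometric_embedding J ?K ?ip"
    by (auto simp: isometric_embedding_def J_def apply_simps cinner_prod_def clinear_on_def
        simp flip: clinear_add[OF lin] clinear_scaleC[OF lin])
  have unitary: "unitary_operator ?K ?ip (conjugated \<Phi> U1)"
    "unitary_operator ?K ?ip (conjugated \<Phi> U2)" "unitary_operator ?K ?ip (conjugated \<Phi> Q')"
    by (intro unitary_operator_conjugated lin inj \<open>unitary U1\<close> \<open>unitary U2\<close> \<open>unitary Q'\<close>)+
  then have comm': "q_commuting ?K ?ip (conjugated \<Phi> Q') (conjugated \<Phi> U1) (conjugated \<Phi> U2)"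
    using U by (auto simp: q_commuting_def unitary_operator_def apply_simps Q'_def)
  have "range P = range (\<lambda>h. (h, 0))" by (auto simp: P_def image_iff)
  then have PJ: "range J = \<Phi> ` range P" by (auto simp: J_def)
  have P: "clinear P" "norm (P k) \<le> norm k" for k
    by (auto simp: P_def norm_prod_def intro!: clinearI real_le_rsqrt)
  have proj: "orthogonal_projection_onto ?K ?ip (range J) (conjugated \<Phi> P)"
    unfolding orthogonal_projection_onto_def
  proof (intro conjI)
    show "bounded_operator ?K ?ip (conjugated \<Phi> P)"
      by (rule bounded_operator_conjugated[OF lin inj P])
    show "is_adjoint ?K ?ip (conjugated \<Phi> P) (conjugated \<Phi> P)"
      by (rule is_adjoint_conjugated[OF lin inj P]) (simp add: P_def cinner_prod_def)
    show "conjugated \<Phi> P ` ?K = range J"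
      by (simp add: PJ image_image apply_simps)
  qed (auto simp: apply_simps P_def)
  have "csubspace (range J)"
    unfolding PJ
    by (rule csubspace_image[OF lin inj]) (auto simp: csubspace_def P_def image_iff zero_prod_def)
  have closed: "closed_csubspace ?K ?ip (range J)"
    unfolding closed_csubspace_def
  proof (intro conjI allI ballI impI)
    show "csubspace (range J)" by fact
    show "range J \<subseteq> ?K" by (auto simp: J_def)
    fix \<sigma> x assume "x \<in> ?K" and "(\<forall>n. \<sigma> n \<in> range J) \<and> (\<lambda>n. hnorm ?ip (\<sigma> n - x)) \<longlonglongrightarrow> 0"
    then obtain k where k: "x = \<Phi> k" and "\<forall>n. \<exists>h. \<sigma> n = J h"
      and lim: "(\<lambda>n. hnorm ?ip (\<sigma> n - x)) \<longlonglongrightarrow> 0" by blast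
    then obtain s where s: "\<And>n. \<sigma> n = J (s n)" by metis
    have "(\<lambda>n. norm ((s n, 0) - k)) \<longlonglongrightarrow> 0"
      using lim by (simp add: s k J_def apply_simps flip: clinear_diff[OF lin])
    then have "(\<lambda>n. (s n, 0)) \<longlonglongrightarrow> k"
      by (simp add: LIM_zero_iff tendsto_norm_zero_iff)
    then have "(\<lambda>n. snd (s n, 0)) \<longlonglongrightarrow> snd k" by (rule tendsto_snd)
    then have "snd k = 0" by (simp add: LIMSEQ_const_iff)
    then have "k = (fst k, 0)" by (simp add: prod_eq_iff)
    then have "x = J (fst k)" unfolding k J_def by (rule arg_cong)
    then show "x \<in> range J" by simp
  qed
  \<comment> \<open>The adjoint of Q' is its inverse, so this provides the invariance under the
    adjoint that a reducing subspace requires.\<close>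
  have "inv Q' (h, 0) = (inv Q h, 0)" for h
  proof -
    have "Q' (inv Q h, 0) = (h, 0)" by (simp add: Q'_def \<open>unitary Q\<close>)
    then show ?thesis by (metis \<open>unitary Q'\<close> unitary_inv_left)
  qed
  then have reducing: "reducing_subspace ?K ?ip (range J) (conjugated \<Phi> Q')"
    unfolding reducing_subspace_def
    using closed is_adjoint_conjugated_unitary[OF lin inj \<open>unitary Q'\<close>]
    by (auto simp: J_def apply_simps Q'_def intro!: exI[of _ "conjugated \<Phi> (inv Q')"])
  have dil': "J ((T1 ^^ k1) ((T2 ^^ k2) h)) =
      conjugated \<Phi> P ((conjugated \<Phi> U1 ^^ k1) ((conjugated \<Phi> U2 ^^ k2) (J h)))" for k1 k2 h
    by (simp add: J_def apply_simps P_def dil)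
  have "conjugated \<Phi> Q' (J h) = J (Q h)" for h
    by (simp add: J_def apply_simps Q'_def)
  with hilbert_space_on_range[OF lin inj] J unitary comm' proj dil' reducing show ?thesis
    by blast
qed

end
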